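(* Let $p>1$ and $p'=p/(p-1)$. Let $f\in C(\mathbb R)$ be locally Lipschitz on $\mathbb R\setminus\{0\}$ with $f(0)=0$, put $F(s):=\int_0^s f(t)\,dt$, and assume there exist $\beta^-<0<\beta^+$ such that $F(s)<0$ for all $s\in(\beta^-,\beta^+)\setminus\{0\}$, $F(\beta^\pm)=0$, $f(s)>0$ for all $s\ge\beta^+$, $f(s)<0$ for all $s\le\beta^-$, and $F(+\infty)=F(-\infty)$. Let $q:(0,\infty)\to(0,\infty)$ be $C^1$ with $q'>0$ on $(0,\infty)$, $q'/q$ strictly decreasing on $(0,\infty)$, and such that there exist $C_1,C_2>0$ with $C_1\le \frac{r\,q'(r)}{q(r)}\le C_2$ for all $r>0$. Assume furthermore that either there exists $\varepsilon>0$ such that $s\mapsto|F(s)|^{-1/p}$ is integrable on $(-\varepsilon,\varepsilon)$, or the function $h(r):=q(r)^{p'}$ is such that $h'$ is non-decreasing and $\lim_{r\to+\infty}h'(r)=+\infty$. Let $\lambda>0$. If $v_\lambda$ is a solution on $[0,\infty)$ of $$\big(q(r)\,\phi_p(v')\big)'+q(r)\,f(v)=0,\quad r>0,\qquad v(0)=\lambda,\quad v'(0)=0,$$ then $v_\lambda$ has at most a finite number of sign changes.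
   Context: $\phi_p(s)=|s|^{p-2}s$ for $s\ne0$ and $\phi_p(0)=0$. $F(\pm\infty)$ denote the (possibly infinite) limits of $F$ at $\pm\infty$. Solutions are classical: $v\in C^1([0,\infty);\mathbb R)$ with $q\,\phi_p(v')\in C^1((0,\infty);\mathbb R)$. *)

theory Defs
  imports "HOL-Analysis.Analysis"
begin

definition phi :: "real \<Rightarrow> real \<Rightarrow> real" where
  "phi p s = (if s = 0 then 0 else \<bar>s\<bar> powr (p - 2) * s)"

(* Oriented integral: for s < 0 this is - (integral of f over (s, 0)). *)
definition primitive :: "(real \<Rightarrow> real) \<Rightarrow> real \<Rightarrow> real" where
  "primitive f s = (LBINT t=ereal 0..ereal s. f t)"

(* Classical solution of (q phi_p(v'))' + q f(v) = 0 on r > 0 with v(0) = lam, v'(0) = 0.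
   The derivative of v at 0 is one-sided; v' is determined by v on {0..}, and the values of v
   on the negative half-line and of q on {..0} play no role. *)
definition is_solution ::
  "real \<Rightarrow> (real \<Rightarrow> real) \<Rightarrow> (real \<Rightarrow> real) \<Rightarrow> real \<Rightarrow> (real \<Rightarrow> real) \<Rightarrow> bool" where
  "is_solution p q f lam v \<longleftrightarrow>
     (\<exists>v'. (\<forall>r\<ge>0. (v has_real_derivative v' r) (at r within {0..})) \<and>
           continuous_on {0..} v' \<and>
           (\<lambda>r. q r * phi p (v' r)) C1_differentiable_on {0<..} \<and>
           (\<forall>r>0. deriv (\<lambda>r. q r * phi p (v' r)) r + q r * f (v r) = 0) \<and>
           v 0 = lam \<and> v' 0 = 0)"

(* Number of sign changes of v on S: the supremum of all n for which there are points
   t 0 < t 1 < ... < t n in S such that v takes nonzero values of opposite signs at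
   consecutive points. In particular, a passage from positive to negative values through an
   interval on which v vanishes counts once, and a zero without change of sign does not count. *)
definition sign_changes :: "real set \<Rightarrow> (real \<Rightarrow> real) \<Rightarrow> enat" where
  "sign_changes S v =
     Sup (enat ` {n. \<exists>t :: nat \<Rightarrow> real. (\<forall>i\<le>n. t i \<in> S) \<and>
        (\<forall>i<n. t i < t (Suc i) \<and> v (t i) * v (t (Suc i)) < 0)})"

end

theory Submission
  imports Defs
begin

text \<open>The energy \<open>E = \<bar>v'\<bar>\<^sup>p / p' + F(v)\<close> has derivative \<open>- (q'/q) \<bar>v'\<bar>\<^sup>p\<close>, so it is nonincreasing, and
  \<open>E \<ge> 0\<close> at zeros of \<open>v\<close>. Hence an extremum of \<open>v\<close> between two sign changes lies outside
  \<open>(\<beta>\<^sup>-, \<beta>\<^sup>+)\<close>; as \<open>v'\<close> is bounded, sign changes cannot accumulate. If there were infinitely many,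
  \<open>v\<close> would cross the well \<open>[\<beta>\<^sup>-, \<beta>\<^sup>+]\<close> at arbitrarily late times with \<open>E > 0\<close> throughout. The time
  spent outside the well per half cycle is bounded since \<open>f\<close> is bounded away from 0 there, and a
  crossing at energy at least \<open>e\<close> takes at most \<open>\<integral> (e - F)\<^bsup>-1/p\<^esup>\<close> over the well. If this stays
  bounded (because \<open>inf E > 0\<close>, or because \<open>\<bar>F\<bar>\<^bsup>-1/p\<^esup>\<close> is integrable), then, as \<open>q'/q \<ge> C\<^sub>1/r\<close>,
  the \<open>n\<close>-th cycle costs an energy of order at least \<open>1/n\<close>, and the harmonic series diverges.
  Otherwise \<open>E \<longlongrightarrow> 0\<close> and \<open>h'\<close> is nondecreasing. Here \<open>(h E)' = h' F(v)\<close>; the part with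
  \<open>F(v) > 0\<close> contributes little because \<open>F(v) \<le> E\<close>, and the following crossing of the well, where
  \<open>h'\<close> is at least as large, makes \<open>h E\<close> drop by a fixed amount per half cycle.\<close>

section \<open>Powers and primitives\<close>

text \<open>At 0 the difference quotient has modulus \<open>\<bar>h\<bar> powr (a - 1)\<close>,
  which tends to 0 because \<open>a > 1\<close>. It is applied with the conjugate exponent to
  \<open>phi p (v' r)\<close>, since \<open>v'\<close> itself need not be differentiable.\<close>

lemma deriv_abs_powr:
  fixes a x :: real
  assumes "a > 1"
  shows "((\<lambda>x. \<bar>x\<bar> powr a) has_real_derivative a * phi a x) (at x)"
proof -
  consider "x > 0" | "x < 0" | "x = 0" by linarith
  then show ?thesis
  proof cases
    case 1
    have d: "((\<lambda>x. x powr a) has_real_derivative a * phi a x) (at x)"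
      using 1 by (auto intro!: derivative_eq_intros simp: phi_def powr_diff powr_numeral power2_eq_square field_simps)
    have ev: "\<forall>\<^sub>F y in nhds x. \<bar>y\<bar> powr a = y powr a"
      using eventually_nhds_in_open[of "{0<..}" x] 1 by (auto elim!: eventually_mono)
    show ?thesis
      by (rule DERIV_cong_ev[OF refl ev refl, THEN iffD2, OF d])
  next
    case 2
    have d: "((\<lambda>x. (- x) powr a) has_real_derivative a * phi a x) (at x)"
      using 2 by (auto intro!: derivative_eq_intros simp: phi_def powr_diff powr_numeral power2_eq_square field_simps)
    have ev: "\<forall>\<^sub>F y in nhds x. \<bar>y\<bar> powr a = (- y) powr a"
      using eventually_nhds_in_open[of "{..<0}" x] 2 by (auto elim!: eventually_mono)
    show ?thesis
      by (rule DERIV_cong_ev[OF refl ev refl, THEN iffD2, OF d])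
  next
    case 3
    have "((\<lambda>h. \<bar>h\<bar> powr (a - 1)) \<longlongrightarrow> \<bar>0\<bar> powr (a - 1)) (at (0::real))"
      using assms by (intro tendsto_intros) auto
    then have "((\<lambda>h. \<bar>h\<bar> powr (a - 1)) \<longlongrightarrow> 0) (at (0::real))"
      by simp
    then have "((\<lambda>h. norm (\<bar>h\<bar> powr a / h)) \<longlongrightarrow> 0) (at 0)"
      by (rule Lim_transform_eventually)
        (auto simp: eventually_at_filter powr_diff abs_divide)
    then have "((\<lambda>h. \<bar>h\<bar> powr a / h) \<longlongrightarrow> 0) (at 0)"
      by (rule tendsto_norm_zero_cancel)
    then show ?thesis
      using 3 assms by (simp add: DERIV_def phi_def)
  qed
qed

lemma abs_phi: "\<bar>phi p x\<bar> = \<bar>x\<bar> powr (p - 1)"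
proof -
  have "\<bar>x\<bar> powr (p - 2) * \<bar>x\<bar> = \<bar>x\<bar> powr (p - 1)" if "x \<noteq> 0"
    using that powr_add[of "\<bar>x\<bar>" "p - 2" 1] by simp
  then show ?thesis
    by (auto simp: phi_def abs_mult)
qed

lemma phi_mult_self: "phi p x * x = \<bar>x\<bar> powr p"
proof -
  have "\<bar>x\<bar> powr (p - 2) * (x * x) = \<bar>x\<bar> powr p" if "x \<noteq> 0"
    using that powr_add[of "\<bar>x\<bar>" "p - 2" 2] by (simp add: powr_numeral power2_eq_square)
  then show ?thesis
    by (auto simp: phi_def mult.assoc)
qed

lemma abs_phi_powr_conjugate:
  assumes "p > 1"
  shows "\<bar>phi p x\<bar> powr (p / (p - 1)) = \<bar>x\<bar> powr p"
  using assms by (simp add: abs_phi powr_powr)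

text \<open>Conjugacy means (p - 1)(p' - 1) = 1, so the two power maps are inverse to each other;
  this recovers \<open>v'\<close> from \<open>phi p (v' r)\<close>.\<close>

lemma phi_conjugate:
  assumes "p > 1"
  shows "phi (p / (p - 1)) (phi p x) = x"
proof (cases "x = 0")
  case False
  have "(p - 1) * (p / (p - 1) - 2) + (p - 2) = 0"
    using assms by (simp add: field_simps)
  then have "\<bar>x\<bar> powr ((p - 1) * (p / (p - 1) - 2)) * \<bar>x\<bar> powr (p - 2) = 1"
    using False by (simp flip: powr_add)
  moreover have "phi (p / (p - 1)) (phi p x)
      = \<bar>x\<bar> powr ((p - 1) * (p / (p - 1) - 2)) * \<bar>x\<bar> powr (p - 2) * x"
    using False abs_phi[of p x]
    by (simp add: phi_def powr_powr)
  ultimately show ?thesis by simp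
qed (simp add: phi_def)

lemma primitive_deriv:
  assumes "continuous_on UNIV f"
  shows "(primitive f has_real_derivative f s) (at s)"
proof -
  \<comment> \<open>The interval contains the base point 0 and has \<open>s\<close> in its interior,
    so the derivative within it is two-sided.\<close>
  define a b where "a = - \<bar>s\<bar> - 1" and "b = \<bar>s\<bar> + 1"
  have "((\<lambda>u. LBINT y=ereal 0..ereal u. f y) has_vector_derivative f s) (at s within {a..b})"
    by (rule interval_integral_FTC2)
      (auto simp: a_def b_def intro: continuous_on_subset[OF assms])
  moreover have "at s within {a..b} = at s"
    by (rule at_within_Icc_at) (auto simp: a_def b_def)
  ultimately show ?thesis
    by (simp add: primitive_def[abs_def] has_real_derivative_iff_has_vector_derivative)
qed

lemma primitive_0: "primitive f 0 = 0"
  by (simp add: primitive_def)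

section \<open>First hitting times and monotonicity\<close>

text \<open>The hitting time is the minimum of the compact set where \<open>u \<le> y\<close>; by
  the intermediate value theorem \<open>u\<close> cannot be strictly below \<open>y\<close>
  there.\<close>

lemma first_hit_below:
  fixes u :: "real \<Rightarrow> real"
  assumes "a \<le> b" and cont: "continuous_on {a..b} u" and "u a \<ge> y" "u b \<le> y"
  obtains t where "a \<le> t" "t \<le> b" "u t = y" "\<And>x. a \<le> x \<Longrightarrow> x < t \<Longrightarrow> u x > y"
proof -
  let ?S = "{t \<in> {a..b}. u t \<le> y}"
  have "closed ?S"
    using continuous_closed_preimage[OF cont, of "{..y}"] by (simp add: vimage_def Int_def)
  moreover have "bounded ?S"
    by (rule bounded_subset[of "{a..b}"]) auto
  ultimately have "compact ?S"
    by (simp add: compact_eq_bounded_closed)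
  moreover have "b \<in> ?S" using assms by auto
  ultimately obtain t where t: "t \<in> ?S" "\<And>x. x \<in> ?S \<Longrightarrow> t \<le> x"
    using compact_attains_inf[of ?S] by blast
  have "continuous_on {a..t} u"
    using t(1) by (auto intro: continuous_on_subset[OF cont])
  then obtain x where "a \<le> x" "x \<le> t" "u x = y"
    using IVT2'[of u t y a] t(1) assms by auto
  then have "u t = y"
    using t by force
  moreover have "u x > y" if "a \<le> x" "x < t" for x
    using t(1) t(2)[of x] that by force
  ultimately show ?thesis
    using that t(1) by auto
qed

lemma first_hit_above:
  fixes u :: "real \<Rightarrow> real"
  assumes "a \<le> b" "continuous_on {a..b} u" "u a \<le> y" "u b \<ge> y"
  obtains t where "a \<le> t" "t \<le> b" "u t = y" "\<And>x. a \<le> x \<Longrightarrow> x < t \<Longrightarrow> u x < y"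
  using first_hit_below[of a b "\<lambda>x. - u x" "- y"] assms
  by (auto intro: continuous_on_minus)

text \<open>A positive slope would place smaller values immediately to the left of \<open>t\<close>.
  This gives the sign of \<open>v'\<close> at first hitting times.\<close>

lemma DERIV_nonpos_first_hit_below:
  fixes u :: "real \<Rightarrow> real"
  assumes "(u has_real_derivative l) (at t)" "a < t" "\<And>x. a \<le> x \<Longrightarrow> x < t \<Longrightarrow> u x > u t"
  shows "l \<le> 0"
proof (rule ccontr)
  assume "\<not> l \<le> 0"
  then obtain d where d: "d > 0" "\<And>h. h > 0 \<Longrightarrow> h < d \<Longrightarrow> u (t - h) < u t"
    using DERIV_pos_inc_left[OF assms(1)] by auto
  define h where "h = min (d / 2) (t - a)"
  have "h > 0" "h < d" "a \<le> t - h" "t - h < t"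
    using d(1) assms(2) by (auto simp: h_def)
  then show False
    using d(2)[of h] assms(3)[of "t - h"] by force
qed

text \<open>Derivatives within the interval suffice for the mean value theorem; integrals taken
  along \<open>v\<close> are differentiated only within a crossing interval.\<close>

lemma DERIV_within_nonpos_le:
  fixes u :: "real \<Rightarrow> real"
  assumes "a < b"
    and "\<And>x. a \<le> x \<Longrightarrow> x \<le> b \<Longrightarrow> (u has_real_derivative u' x) (at x within {a..b})"
    and "\<And>x. a \<le> x \<Longrightarrow> x \<le> b \<Longrightarrow> u' x \<le> 0"
  shows "u b \<le> u a"
proof -
  obtain x where "x \<in> {a<..<b}" "u b - u a = u' x * (b - a)"
    using mvt_simple[OF assms(1), of u "\<lambda>x. (*) (u' x)"] assms(2)
    by (auto simp: has_field_derivative_def)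
  moreover have "u' x * (b - a) \<le> 0"
    using assms(1,3) calculation by (auto simp: mult_le_0_iff)
  ultimately show ?thesis by simp
qed

text \<open>For \<open>x \<ge> k\<close> one factor \<open>x powr (p - 1)\<close> is bounded below;
  for \<open>x < k\<close> the left side is nonpositive. With \<open>x\<close> a speed, the linear
  bound integrates to displacement minus a multiple of time, replacing Hoelder's inequality.\<close>

lemma powr_ge_linear:
  fixes x k p :: real
  assumes "p > 1" "x \<ge> 0" "k > 0"
  shows "k powr (p - 1) * (x - k) \<le> x powr p"
proof (cases "x \<ge> k")
  case True
  have "k powr (p - 1) * (x - k) \<le> k powr (p - 1) * x"
    using assms by (intro mult_left_mono) auto
  also have "\<dots> \<le> x powr (p - 1) * x"
    using assms True by (intro mult_right_mono powr_mono2) auto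
  also have "\<dots> = x powr p"
    using assms True powr_add[of x "p - 1" 1] by simp
  finally show ?thesis .
next
  case False
  then have "k powr (p - 1) * (x - k) \<le> 0"
    by (intro mult_nonneg_nonpos) auto
  then show ?thesis
    by (meson order_trans powr_ge_zero)
qed

section \<open>Late oscillations\<close>

text \<open>A solution with late oscillations, abstracted to what the decay argument needs; \<open>w\<close> stands
  for \<open>\<phi>\<^sub>p(v')\<close>, \<open>E\<close> for the energy and \<open>k\<close> for \<open>q'/q\<close>. The well \<open>[bm, bp]\<close> is chosen slightly
  smaller than \<open>[\<beta>\<^sup>-, \<beta>\<^sup>+]\<close>, so that \<open>f\<close> is bounded away from 0 outside it.\<close>

locale oscillation =
  fixes p bm bp a c K V C R :: real and F v v' w w' E k :: "real \<Rightarrow> real"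
  assumes p: "p > 1"
    and b: "bm < 0" "0 < bp"
    and F_cont: "continuous_on UNIV F"
    and F_neg: "\<And>s. bm \<le> s \<Longrightarrow> s \<le> bp \<Longrightarrow> s \<noteq> 0 \<Longrightarrow> F s < 0"
    and F_0: "F 0 = 0"
    and R: "R > 0"
    and pars: "0 < a" "a \<le> 1" "c > 0" "C > 0" "V > 0" "K \<ge> 0"
    and v_deriv: "\<And>r. r \<ge> R \<Longrightarrow> (v has_real_derivative v' r) (at r)"
    and v'_cont: "continuous_on {R..} v'"
    and w_deriv: "\<And>r. r \<ge> R \<Longrightarrow> (w has_real_derivative w' r) (at r)"
    and w_bound: "\<And>r. r \<ge> R \<Longrightarrow> \<bar>w r\<bar> \<le> K"
    and w'_upper: "\<And>r. r \<ge> R \<Longrightarrow> v r \<ge> bp \<Longrightarrow> w' r \<le> - c"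
    and w'_lower: "\<And>r. r \<ge> R \<Longrightarrow> v r \<le> bm \<Longrightarrow> c \<le> w' r"
    and v'_bound: "\<And>r. r \<ge> R \<Longrightarrow> \<bar>v' r\<bar> \<le> V"
    and E_eq: "\<And>r. r \<ge> R \<Longrightarrow> E r = a * \<bar>v' r\<bar> powr p + F (v r)"
    and E_deriv: "\<And>r. r \<ge> R \<Longrightarrow> (E has_real_derivative - (k r * \<bar>v' r\<bar> powr p)) (at r)"
    and k_ge: "\<And>r. r \<ge> R \<Longrightarrow> C / r \<le> k r"
    and E_pos: "\<And>r. r \<ge> R \<Longrightarrow> E r > 0"
    and late_above: "\<And>T. \<exists>t\<ge>T. v t > bp"
    and late_below: "\<And>T. \<exists>t\<ge>T. v t < bm"
begin

text \<open>The symmetry \<open>v \<mapsto> - v\<close> swaps the two sides of the well and keeps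
  \<open>E\<close> and \<open>k\<close>, so only excursions below the well need to be
  studied.\<close>

lemma reflected:
  "oscillation p (- bp) (- bm) a c K V C R (\<lambda>s. F (- s)) (\<lambda>r. - v r) (\<lambda>r. - v' r)
     (\<lambda>r. - w r) (\<lambda>r. - w' r) E k"
  using p b F_0 R pars v'_cont w_bound w'_upper w'_lower v'_bound E_eq E_deriv k_ge E_pos
    late_above late_below
  by unfold_locales
    (auto intro!: derivative_eq_intros v_deriv w_deriv F_neg continuous_intros
      continuous_on_compose2[OF F_cont] simp: less_minus_iff minus_less_iff le_minus_iff minus_le_iff)

lemma F_le_0: "bm \<le> s \<Longrightarrow> s \<le> bp \<Longrightarrow> F s \<le> 0"
  using F_neg[of s] F_0 by fastforce

lemma v_cont: "continuous_on {R..} v"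
  using v_deriv DERIV_isCont by (blast intro: continuous_at_imp_continuous_on atLeast_iff)

lemma k_nonneg: "r \<ge> R \<Longrightarrow> k r \<ge> 0"
  using k_ge[of r] R pars by (meson divide_nonneg_pos less_eq_real_def order_less_le_trans order_trans)

lemma E_antimono:
  assumes "R \<le> r" "r \<le> s"
  shows "E s \<le> E r"
proof (rule DERIV_nonpos_imp_nonincreasing[OF assms(2)])
  fix x assume "r \<le> x" "x \<le> s"
  then show "\<exists>y. (E has_real_derivative y) (at x) \<and> y \<le> 0"
    using E_deriv[of x] k_nonneg[of x] assms by (intro exI conjI) auto
qed

text \<open>In the well the potential is nonpositive, so positive energy must be kinetic: turning
  points lie outside.\<close>

lemma v'_nonzero:
  assumes "r \<ge> R" "bm \<le> v r" "v r \<le> bp"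
  shows "v' r \<noteq> 0"
  using E_pos[of r] E_eq[of r] F_le_0[of "v r"] assms p by auto

lemma v_sub: "R \<le> x \<Longrightarrow> x < y \<Longrightarrow> \<exists>z. x < z \<and> z < y \<and> v y - v x = (y - x) * v' z"
  using MVT2[of x y v v'] v_deriv by auto

section \<open>The shape of a half cycle\<close>

lemma start:
  obtains s where "s \<ge> T" "s \<ge> R" "v s = bm" "v' s < 0"
proof -
  obtain t1 where t1: "t1 \<ge> max T R" "v t1 > bp"
    using late_above by blast
  obtain t2 where t2: "t2 \<ge> t1" "v t2 < bm"
    using late_below by blast
  obtain s where s: "t1 \<le> s" "s \<le> t2" "v s = bm" "\<And>x. t1 \<le> x \<Longrightarrow> x < s \<Longrightarrow> v x > bm"
    using first_hit_below[of t1 t2 v bm] t1 t2 b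
      continuous_on_subset[OF v_cont, of "{t1..t2}"] by auto
  have "t1 < s" using s t1 b by (cases "t1 = s") auto
  then have "v' s \<le> 0"
    using DERIV_nonpos_first_hit_below[OF v_deriv, of s t1] s t1 by auto
  moreover have "v' s \<noteq> 0" using v'_nonzero[of s] s t1 b by auto
  ultimately show ?thesis using that[of s] s t1 by simp
qed

text \<open>After leaving the well downwards at \<open>s\<close>, the solution turns, re-enters at
  \<open>s1\<close> and climbs monotonically to the other edge at \<open>s2\<close>.\<close>

lemma half_cycle:
  assumes s: "s \<ge> R" "v s = bm" "v' s < 0"
  obtains s1 s2 where "s < s1" "s1 < s2" "v s1 = bm" "v s2 = bp" "s1 - s \<le> 2 * K / c"
    "\<And>x. s \<le> x \<Longrightarrow> x \<le> s1 \<Longrightarrow> v x \<le> bm"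
    "\<And>x. s1 \<le> x \<Longrightarrow> x \<le> s2 \<Longrightarrow> v' x > 0 \<and> bm \<le> v x \<and> v x \<le> bp"
proof -
  have cont: "continuous_on {x..y} v" "continuous_on {x..y} v'" if "R \<le> x" for x y
    using that by (auto intro: continuous_on_subset[OF v_cont] continuous_on_subset[OF v'_cont])
  obtain t where t: "t \<ge> s" "v t > bp"
    using late_above by blast
  have "s < t" using t s b by (cases "s = t") auto
  then obtain \<xi> where \<xi>: "s < \<xi>" "v t - v s = (t - s) * v' \<xi>"
    using v_sub[of s t] s by auto
  moreover have "v t - v s > 0" using t s b by simp
  ultimately have "v' \<xi> > 0" using \<open>s < t\<close> by (simp add: zero_less_mult_iff)
  \<comment> \<open>\<open>v'\<close> is negative at \<open>s\<close> and positive at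
    \<open>\<xi>\<close>, so \<open>m\<close> is the first turning point after
    \<open>s\<close>.\<close>
  then obtain m where m: "s \<le> m" "m \<le> \<xi>" "v' m = 0" "\<And>x. s \<le> x \<Longrightarrow> x < m \<Longrightarrow> v' x < 0"
    using first_hit_above[of s \<xi> v' 0] s \<xi> cont[of s] by auto
  have "s < m" using m s by (cases "s = m") auto
  have desc: "v x \<le> bm" if "s \<le> x" "x \<le> m" for x
  proof (cases "s = x")
    case False
    then have "s < x" using that by simp
    then obtain z where "s < z" "z < x" "v x - v s = (x - s) * v' z"
      using v_sub[of s x] s by auto
    moreover have "v' z < 0" using m(4)[of z] calculation that by auto
    ultimately have "v x - v s \<le> 0"
      using that by (simp add: mult_le_0_iff)
    then show ?thesis using s by simp
  qed (use s in auto)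
  have "v m < bm"
    using v'_nonzero[of m] m s desc[of m] b by force
  obtain t' where t': "t' \<ge> m" "v t' > bp"
    using late_above by blast
  obtain s1 where s1: "m \<le> s1" "v s1 = bm" "\<And>x. m \<le> x \<Longrightarrow> x < s1 \<Longrightarrow> v x < bm"
  proof (rule first_hit_above[OF t'(1) cont(1), of bm])
    show "R \<le> m" using s(1) m(1) by simp
    show "v m \<le> bm" "bm \<le> v t'" using \<open>v m < bm\<close> t'(2) b by auto
  qed blast
  have "m < s1" using s1 \<open>v m < bm\<close> by (cases "m = s1") auto
  have R1: "R \<le> s1" "s < s1" using s m \<open>m < s1\<close> by auto
  have "- v' s1 \<le> 0"
    using DERIV_nonpos_first_hit_below[OF DERIV_minus[OF v_deriv], of s1 m] s1 R1 \<open>m < s1\<close> by auto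
  moreover have "v' s1 \<noteq> 0"
    using v'_nonzero[of s1] s1 R1 b by auto
  ultimately have "v' s1 > 0" by simp
  have outer: "v x \<le> bm" if "s \<le> x" "x \<le> s1" for x
    using desc[of x] s1(2) s1(3)[of x] that by (cases "x \<le> m"; cases "x = s1") auto
  \<comment> \<open>Below the well \<open>w\<close> grows at rate at least \<open>c\<close>, yet it
    can change by at most \<open>2 * K\<close>; this bounds the time spent there.\<close>
  obtain z where z: "s < z" "z < s1" "w s1 - w s = (s1 - s) * w' z"
    using MVT2[of s s1 w w'] w_deriv s R1 by auto
  have "(s1 - s) * c \<le> (s1 - s) * w' z"
    using w'_lower[of z] outer[of z] z s R1 by (intro mult_left_mono) auto
  also have "\<dots> \<le> 2 * K"
    using w_bound[of s] w_bound[of s1] s R1 z by (auto simp: abs_le_iff)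
  finally have time: "s1 - s \<le> 2 * K / c"
    using pars by (simp add: field_simps)
  \<comment> \<open>A later visit below \<open>bm\<close> forces \<open>v'\<close> to become
    negative again, so it has a first zero \<open>n\<close> after \<open>s1\<close>. This turning
    point is not in the well, so \<open>v\<close> has passed \<open>bp\<close> before it.\<close>
  obtain u where u: "u \<ge> s1" "v u < bm"
    using late_below by blast
  have "s1 < u" using u s1 by (cases "s1 = u") auto
  then obtain \<eta> where \<eta>: "s1 < \<eta>" "v u - v s1 = (u - s1) * v' \<eta>"
    using v_sub[of s1 u] R1 by auto
  moreover have "v u - v s1 < 0" using u s1 by simp
  ultimately have "v' \<eta> < 0" using \<open>s1 < u\<close> by (simp add: mult_less_0_iff)
  then obtain n where n: "s1 \<le> n" "n \<le> \<eta>" "v' n = 0" "\<And>x. s1 \<le> x \<Longrightarrow> x < n \<Longrightarrow> v' x > 0"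
    using first_hit_below[of s1 \<eta> v' 0] \<open>v' s1 > 0\<close> R1 \<eta> cont[of s1] by auto
  have asc: "v x < v y" if "s1 \<le> x" "x < y" "y \<le> n" for x y
  proof -
    have "R \<le> x" using that R1 by simp
    then obtain z where "x < z" "z < y" "v y - v x = (y - x) * v' z"
      using v_sub[OF _ \<open>x < y\<close>] by blast
    moreover have "v' z > 0" using n(4)[of z] calculation that by auto
    ultimately have "v y - v x > 0"
      using that by simp
    then show ?thesis by simp
  qed
  have "s1 < n" using n \<open>v' s1 > 0\<close> by (cases "s1 = n") auto
  then have "v n > bp"
    using v'_nonzero[of n] n R1 asc[of s1 n] s1 by force
  then obtain s2 where s2: "s1 \<le> s2" "s2 \<le> n" "v s2 = bp"
    using IVT'[of v s1 bp n] s1 b n cont[of s1 n] R1 by auto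
  have "s1 < s2" "s2 < n"
    using s2 s1 b \<open>v n > bp\<close> by (auto simp: less_le)
  show ?thesis
  proof (rule that[OF R1(2) \<open>s1 < s2\<close> s1(2) s2(3) time outer])
    fix x assume x: "s1 \<le> x" "x \<le> s2"
    then show "v' x > 0 \<and> bm \<le> v x \<and> v x \<le> bp"
      using n(4)[of x] asc[of s1 x] asc[of x s2] s1(2) s2 \<open>s2 < n\<close>
      by (cases "x = s1"; cases "x = s2") auto
  qed auto
qed

section \<open>Duration and energy loss of a crossing\<close>

lemma DERIV_integral_along:
  assumes g: "continuous_on {bm..bp} g" and "R \<le> s1" "s1 \<le> t" "t \<le> s2"
    and cross: "\<And>x. s1 \<le> x \<Longrightarrow> x \<le> s2 \<Longrightarrow> v' x > 0 \<and> bm \<le> v x \<and> v x \<le> bp"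
  shows "((\<lambda>t. integral {bm..v t} g) has_real_derivative g (v t) * v' t) (at t within {s1..s2})"
proof -
  have "((\<lambda>u. integral {bm..u} g) has_real_derivative g (v t)) (at (v t) within {bm..bp})"
    using integral_has_real_derivative[OF g, of "v t"] cross[of t] assms by auto
  then have "((\<lambda>u. integral {bm..u} g) has_real_derivative g (v t)) (at (v t) within v ` {s1..s2})"
    by (rule DERIV_subset) (use cross in auto)
  moreover have "(v has_real_derivative v' t) (at t within {s1..s2})"
    using v_deriv[of t] assms has_field_derivative_at_within by auto
  ultimately show ?thesis
    using DERIV_image_chain by (fastforce simp: o_def)
qed

text \<open>During the crossing the energy is at least \<open>E s2\<close>, and
  \<open>a \<le> 1\<close>, so the speed is at least \<open>(E s2 - F (v t)) powr (1 / p)\<close>.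
  Separating variables bounds the time: \<open>t\<close> minus the integral up to \<open>v t\<close>
  is nonincreasing.\<close>

lemma crossing_time:
  assumes s: "R \<le> s1" "s1 < s2" "v s1 = bm" "v s2 = bp"
    and cross: "\<And>x. s1 \<le> x \<Longrightarrow> x \<le> s2 \<Longrightarrow> v' x > 0 \<and> bm \<le> v x \<and> v x \<le> bp"
  shows "s2 - s1 \<le> integral {bm..bp} (\<lambda>s. (E s2 - F s) powr (- 1 / p))"
proof -
  let ?g = "\<lambda>s. (E s2 - F s) powr (- 1 / p)"
  have pos: "E s2 - F s > 0" if "bm \<le> s" "s \<le> bp" for s
    using E_pos[of s2] F_le_0[OF that] s by auto
  have g: "continuous_on {bm..bp} ?g"
    using pos by (intro continuous_intros continuous_on_subset[OF F_cont]) force+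
  have "s2 - integral {bm..v s2} ?g \<le> s1 - integral {bm..v s1} ?g"
  proof (rule DERIV_within_nonpos_le[OF s(2), where u' = "\<lambda>t. 1 - ?g (v t) * v' t"])
    fix t assume t: "s1 \<le> t" "t \<le> s2"
    show "((\<lambda>t. t - integral {bm..v t} ?g) has_real_derivative 1 - ?g (v t) * v' t) (at t within {s1..s2})"
      by (intro derivative_intros DERIV_integral_along[OF g] s t cross)
    have v't: "v' t > 0" "E s2 - F (v t) > 0"
      using cross t pos by auto
    have "E s2 - F (v t) \<le> E t - F (v t)"
      using E_antimono[of t s2] s t by auto
    also have "\<dots> = a * v' t powr p"
      using E_eq[of t] v't s t by auto
    also have "\<dots> \<le> 1 * v' t powr p"
      using pars by (intro mult_right_mono) auto
    finally have "(E s2 - F (v t)) powr (1 / p) \<le> (v' t powr p) powr (1 / p)"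
      using v't p by (intro powr_mono2) auto
    then have "(E s2 - F (v t)) powr (1 / p) \<le> v' t"
      using v't p by (simp add: powr_powr)
    then have "?g (v t) * (E s2 - F (v t)) powr (1 / p) \<le> ?g (v t) * v' t"
      by (intro mult_left_mono) auto
    moreover have "?g (v t) * (E s2 - F (v t)) powr (1 / p) = 1"
      using v't by (simp flip: powr_add)
    ultimately show "1 - ?g (v t) * v' t \<le> 0"
      by simp
  qed
  then show ?thesis
    using s by simp
qed

text \<open>The dissipation rate is \<open>k t * \<bar>v' t\<bar> powr p\<close> with
  \<open>k t \<ge> C / t \<ge> C / s2\<close>. Replacing the power by its linear minorant at speed
  \<open>\<kappa>\<close> leaves only the width of the well and the duration;
  \<open>\<kappa>\<close> is still free.\<close>

lemma crossing_loss:
  assumes s: "R \<le> s1" "s1 < s2" "v s1 = bm" "v s2 = bp" and \<kappa>: "\<kappa> > 0"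
    and cross: "\<And>x. s1 \<le> x \<Longrightarrow> x \<le> s2 \<Longrightarrow> v' x > 0 \<and> bm \<le> v x \<and> v x \<le> bp"
  shows "E s2 \<le> E s1 - C / s2 * (\<kappa> powr (p - 1) * (bp - bm - \<kappa> * (s2 - s1)))"
proof -
  define A where "A = C / s2 * \<kappa> powr (p - 1)"
  have "E s2 + A * (v s2 - \<kappa> * s2) \<le> E s1 + A * (v s1 - \<kappa> * s1)"
  proof (rule DERIV_nonpos_imp_nonincreasing[where f = "\<lambda>t. E t + A * (v t - \<kappa> * t)"])
    fix t assume t: "s1 \<le> t" "t \<le> s2"
    then have "R \<le> t" "v' t > 0" using s cross by auto
    have "A * (v' t - \<kappa>) = C / s2 * (\<kappa> powr (p - 1) * (v' t - \<kappa>))"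
      by (simp add: A_def)
    also have "\<dots> \<le> C / s2 * v' t powr p"
      using powr_ge_linear[OF p _ \<kappa>, of "v' t"] \<open>v' t > 0\<close> pars R s
      by (intro mult_left_mono) auto
    also have "\<dots> \<le> k t * v' t powr p"
    proof (rule mult_right_mono)
      have "C / s2 \<le> C / t"
        using \<open>R \<le> t\<close> t R pars by (intro divide_left_mono) auto
      then show "C / s2 \<le> k t"
        using k_ge[OF \<open>R \<le> t\<close>] by simp
    qed auto
    finally have "- (k t * \<bar>v' t\<bar> powr p) + A * (v' t - \<kappa>) \<le> 0"
      using \<open>v' t > 0\<close> by simp
    moreover have "((\<lambda>t. E t + A * (v t - \<kappa> * t)) has_real_derivative
        - (k t * \<bar>v' t\<bar> powr p) + A * (v' t - \<kappa>)) (at t)"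
      by (rule derivative_eq_intros E_deriv[OF \<open>R \<le> t\<close>] v_deriv[OF \<open>R \<le> t\<close>] refl)+ simp
    ultimately show "\<exists>y. ((\<lambda>t. E t + A * (v t - \<kappa> * t)) has_real_derivative y) (at t) \<and> y \<le> 0"
      by blast
  qed (use s in simp)
  then have "E s2 \<le> E s1 - A * (bp - bm - \<kappa> * (s2 - s1))"
    using s by (simp add: algebra_simps)
  then show ?thesis
    by (simp add: A_def)
qed

text \<open>This is the loss in a crossing of duration at most \<open>I\<close>, up to the factor
  \<open>1 / s2\<close>. The choice of \<open>\<kappa>\<close> as half the lowest possible mean
  speed \<open>(bp - bm) / I\<close> keeps at least half the width in the bound.\<close>

definition loss :: "real \<Rightarrow> real" where
  "loss I = C * (((bp - bm) / (2 * I)) powr (p - 1) * ((bp - bm) / 2))"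

lemma loss_pos: "I > 0 \<Longrightarrow> loss I > 0"
  using pars b by (simp add: loss_def)

lemma half_cycle_loss:
  assumes I: "I > 0" "\<And>r. r \<ge> R \<Longrightarrow> integral {bm..bp} (\<lambda>s. (E r - F s) powr (- 1 / p)) \<le> I"
    and s: "s \<ge> R" "v s = bm" "v' s < 0"
  shows "\<exists>s2>s. v s2 = bp \<and> v' s2 > 0 \<and> s2 \<le> s + (2 * K / c + I) \<and> E s2 \<le> E s - loss I / s2"
proof -
  obtain s1 s2 where h: "s < s1" "s1 < s2" "v s1 = bm" "v s2 = bp" "s1 - s \<le> 2 * K / c"
    and cross: "\<And>x. s1 \<le> x \<Longrightarrow> x \<le> s2 \<Longrightarrow> v' x > 0 \<and> bm \<le> v x \<and> v x \<le> bp"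
    using half_cycle[OF s] by metis
  have R1: "R \<le> s1" "R \<le> s2" using h s by auto
  have time: "s2 - s1 \<le> I"
    using crossing_time[OF R1(1) h(2-4) cross] I(2)[OF R1(2)] by simp
  let ?D = "bp - bm"
  let ?\<kappa> = "?D / (2 * I)"
  have "?\<kappa> > 0" using b I by simp
  have "?\<kappa> * (s2 - s1) \<le> ?\<kappa> * I"
    using time \<open>?\<kappa> > 0\<close> by (intro mult_left_mono) auto
  also have "\<dots> = ?D / 2" using I by simp
  finally have "?D / 2 \<le> ?D - ?\<kappa> * (s2 - s1)" by (simp add: field_simps)
  then have "C / s2 * (?\<kappa> powr (p - 1) * (?D / 2)) \<le> C / s2 * (?\<kappa> powr (p - 1) * (?D - ?\<kappa> * (s2 - s1)))"
    using pars R R1 by (intro mult_left_mono) auto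
  then have "E s2 \<le> E s1 - loss I / s2"
    using crossing_loss[OF R1(1) h(2-4) \<open>?\<kappa> > 0\<close> cross] by (simp add: loss_def)
  moreover have "E s1 \<le> E s"
    using E_antimono s h by simp
  ultimately show ?thesis
    using h cross[of s2] time by (intro exI[of _ s2]) auto
qed

text \<open>The second half cycle is the first one for the reflected solution. Only its loss is
  kept; the loss in the first half is merely nonnegative.\<close>

lemma cycle_loss:
  assumes I: "I > 0" "\<And>r. r \<ge> R \<Longrightarrow> integral {bm..bp} (\<lambda>s. (E r - F s) powr (- 1 / p)) \<le> I"
    and s: "s \<ge> R" "v s = bm" "v' s < 0"
  shows "\<exists>s'>s. v s' = bm \<and> v' s' < 0 \<and> s' \<le> s + 2 * (2 * K / c + I) \<and> E s' \<le> E s - loss I / s'"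
proof -
  interpret refl: oscillation p "- bp" "- bm" a c K V C R "\<lambda>s. F (- s)" "\<lambda>r. - v r" "\<lambda>r. - v' r"
     "\<lambda>r. - w r" "\<lambda>r. - w' r" E k
    by (rule reflected)
  obtain s1 where s1: "s1 > s" "v s1 = bp" "v' s1 > 0" "s1 \<le> s + (2 * K / c + I)" "E s1 \<le> E s - loss I / s1"
    using half_cycle_loss[OF I s] by blast
  have "integral {- bp..- bm} (\<lambda>s. (E r - F (- s)) powr (- 1 / p)) \<le> I" if "r \<ge> R" for r
    using I(2)[OF that] Henstock_Kurzweil_Integration.integral_reflect_real[of bp bm "\<lambda>s. (E r - F s) powr (- 1 / p)"] by simp
  then obtain s2 where s2: "s2 > s1" "v s2 = bm" "v' s2 < 0" "s2 \<le> s1 + (2 * K / c + I)"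
    "E s2 \<le> E s1 - refl.loss I / s2"
    using refl.half_cycle_loss[OF I(1), of s1] s s1 by auto
  have "refl.loss I = loss I"
    by (simp add: loss_def refl.loss_def)
  moreover have "loss I / s1 > 0"
    using loss_pos[OF I(1)] s s1 R by simp
  ultimately show ?thesis
    using s1 s2 by (intro exI[of _ s2]) auto
qed

text \<open>Cycles last at most \<open>T\<close>, so the \<open>n\<close>-th one ends no later than
  \<open>(s0 + T) * n\<close> and costs at least \<open>A / n\<close>. The harmonic sum eventually
  exceeds the available energy \<open>E s0\<close>.\<close>

lemma bounded_crossing_contradiction:
  assumes I: "I > 0" "\<And>r. r \<ge> R \<Longrightarrow> integral {bm..bp} (\<lambda>s. (E r - F s) powr (- 1 / p)) \<le> I"
  shows False
proof -
  define T where "T = 2 * (2 * K / c + I)"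
  have "T > 0" using pars I by (auto simp: T_def intro!: add_nonneg_pos)
  obtain s0 where s0: "s0 \<ge> R" "v s0 = bm" "v' s0 < 0"
    using start by blast
  define A where "A = loss I / (s0 + T)"
  have "A > 0" using loss_pos[OF I(1)] s0 R \<open>T > 0\<close> by (simp add: A_def)
  have iter: "\<exists>s\<ge>s0. v s = bm \<and> v' s < 0 \<and> s \<le> s0 + n * T \<and> E s \<le> E s0 - A * harm n" for n
  proof (induction n)
    case 0
    then show ?case using s0 by (auto simp: harm_def)
  next
    case (Suc n)
    then obtain s where s: "s \<ge> s0" "v s = bm" "v' s < 0" "s \<le> s0 + n * T" "E s \<le> E s0 - A * harm n"
      by blast
    then obtain s' where s': "s' > s" "v s' = bm" "v' s' < 0" "s' \<le> s + T" "E s' \<le> E s - loss I / s'"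
      using cycle_loss[OF I, of s] s0 by (auto simp: T_def)
    have "s' \<le> s0 + Suc n * T"
      using s s' by (simp add: algebra_simps)
    also have "\<dots> \<le> (s0 + T) * Suc n"
      using s0 R by (simp add: algebra_simps)
    finally have "loss I / ((s0 + T) * Suc n) \<le> loss I / s'"
      using s s' s0 R loss_pos[OF I(1)] by (intro divide_left_mono) auto
    moreover have "A * inverse (Suc n) = loss I / ((s0 + T) * Suc n)"
      by (simp add: A_def divide_inverse)
    ultimately have "E s' \<le> E s0 - A * harm (Suc n)"
      using s s' by (simp add: harm_Suc distrib_left)
    then show ?case
      using s s' \<open>s' \<le> s0 + Suc n * T\<close> by (intro exI[of _ s']) auto
  qed
  have "filterlim (harm :: nat \<Rightarrow> real) at_top sequentially"
    by (rule harm_at_top)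
  then have "\<forall>\<^sub>F n in sequentially. E s0 / A \<le> harm n"
    unfolding filterlim_at_top by blast
  then obtain n where "E s0 / A \<le> harm n"
    unfolding eventually_sequentially by blast
  then have "A * harm n \<ge> E s0"
    using \<open>A > 0\<close> by (simp add: field_simps)
  moreover obtain s where "s \<ge> s0" "E s \<le> E s0 - A * harm n"
    using iter by blast
  ultimately show False
    using E_pos[of s] s0 by simp
qed

section \<open>Decay of the weighted energy \<open>h E\<close>\<close>

lemma half_cycle_weighted_loss:
  assumes h: "\<And>r. r \<ge> R \<Longrightarrow> (h has_real_derivative h' r) (at r)"
    "\<And>r. r \<ge> R \<Longrightarrow> a * h' r = h r * k r"
    "\<And>r s. R \<le> r \<Longrightarrow> r \<le> s \<Longrightarrow> h' r \<le> h' s" "h' R > 0"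
    and J: "J = integral {bm..bp} (\<lambda>s. - F s)"
    and E_R: "E R * (2 * K / c) \<le> J / (2 * V)"
    and s: "s \<ge> R" "v s = bm" "v' s < 0"
  shows "\<exists>s2>s. v s2 = bp \<and> v' s2 > 0 \<and> h s2 * E s2 \<le> h s * E s - h' R * (J / (2 * V))"
proof -
  obtain s1 s2 where hc: "s < s1" "s1 < s2" "v s1 = bm" "v s2 = bp" "s1 - s \<le> 2 * K / c"
    and cross: "\<And>x. s1 \<le> x \<Longrightarrow> x \<le> s2 \<Longrightarrow> v' x > 0 \<and> bm \<le> v x \<and> v x \<le> bp"
    using half_cycle[OF s] by metis
  have R1: "R \<le> s1" "R \<le> s2" using hc s by auto
  \<comment> \<open>The relation \<open>a * h' r = h r * k r\<close> makes the dissipation cancel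
    the kinetic part of \<open>h' r * E r\<close>, leaving only the potential.\<close>
  have deriv: "((\<lambda>r. h r * E r) has_real_derivative h' r * F (v r)) (at r)" if "r \<ge> R" for r
  proof -
    have "h r * (- (k r * \<bar>v' r\<bar> powr p)) + h' r * E r = h' r * F (v r)"
      using h(2)[OF that] E_eq[OF that] by (simp add: algebra_simps)
    then show ?thesis
      using DERIV_mult[OF h(1)[OF that] E_deriv[OF that]] by (simp add: algebra_simps)
  qed
  have h'_pos: "h' r > 0" if "r \<ge> R" for r
    using h(3)[of R r] h(4) that by simp
  obtain z where z: "s < z" "z < s1" "h s1 * E s1 - h s * E s = (s1 - s) * (h' z * F (v z))"
    using MVT2[of s s1 "\<lambda>r. h r * E r" "\<lambda>r. h' r * F (v r)"] deriv hc s by auto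
  \<comment> \<open>Outside the well \<open>h E\<close> may grow, but only at rate at most
    \<open>h' s1 * E R\<close> and for a time at most \<open>2 * K / c\<close>; smallness of
    \<open>E R\<close> limits the gain to \<open>h' s1 * (J / (2 * V))\<close>.\<close>
  have Fz: "F (v z) \<le> E R"
  proof -
    have "0 \<le> a * \<bar>v' z\<bar> powr p"
      using pars by simp
    then show ?thesis
      using E_eq[of z] E_antimono[of R z] z s by linarith
  qed
  have "h' z * F (v z) \<le> h' z * E R"
    using Fz h'_pos[of z] z s by (intro mult_left_mono) auto
  also have "\<dots> \<le> h' s1 * E R"
    using h(3)[of z s1] E_pos[of R] z s by (intro mult_right_mono) auto
  finally have "(s1 - s) * (h' z * F (v z)) \<le> (s1 - s) * (h' s1 * E R)"
    using hc by (intro mult_left_mono) auto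
  also have "\<dots> \<le> 2 * K / c * (h' s1 * E R)"
    using hc h'_pos[OF R1(1)] E_pos[of R] by (intro mult_right_mono) auto
  also have "\<dots> = h' s1 * (E R * (2 * K / c))"
    by simp
  also have "\<dots> \<le> h' s1 * (J / (2 * V))"
    using E_R h'_pos[OF R1(1)] by (intro mult_left_mono) auto
  finally have outer: "h s1 * E s1 \<le> h s * E s + h' s1 * (J / (2 * V))"
    using z by simp
  have g: "continuous_on {bm..bp} (\<lambda>s. - F s)"
    by (intro continuous_intros continuous_on_subset[OF F_cont]) auto
  let ?u' = "\<lambda>t. h' t * F (v t) + h' s1 / V * (- F (v t) * v' t)"
  \<comment> \<open>In the well \<open>F\<close> is nonpositive, \<open>h'\<close> is at least
    \<open>h' s1\<close> and \<open>v' t / V \<le> 1\<close>, so integration over time can be traded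
    for integration over the well. The drop \<open>h' s1 * (J / V)\<close> is twice the gain allowed
    outside.\<close>
  have "h s2 * E s2 + h' s1 / V * integral {bm..v s2} (\<lambda>s. - F s)
      \<le> h s1 * E s1 + h' s1 / V * integral {bm..v s1} (\<lambda>s. - F s)"
  proof (rule DERIV_within_nonpos_le[OF hc(2), where u' = ?u'])
    fix t assume t: "s1 \<le> t" "t \<le> s2"
    have "((\<lambda>t. h t * E t) has_real_derivative h' t * F (v t)) (at t within {s1..s2})"
      using deriv[of t] t R1 has_field_derivative_at_within by auto
    then show "((\<lambda>t. h t * E t + h' s1 / V * integral {bm..v t} (\<lambda>s. - F s)) has_real_derivative ?u' t)
        (at t within {s1..s2})"
      by (intro DERIV_add DERIV_cmult DERIV_integral_along[OF g] R1 t cross)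
    have F: "F (v t) \<le> 0" using F_le_0 cross t by auto
    have "h' t * F (v t) \<le> h' s1 * F (v t)"
      using h(3)[OF R1(1) t(1)] F by (intro mult_right_mono_neg) auto
    moreover have "v' t / V \<le> 1"
      using v'_bound[of t] t R1 pars by auto
    then have "(h' s1 * F (v t)) * 1 \<le> (h' s1 * F (v t)) * (v' t / V)"
      using F h'_pos[OF R1(1)] by (intro mult_left_mono_neg) (auto simp: mult_le_0_iff)
    ultimately show "?u' t \<le> 0" by simp
  qed
  then have "h s2 * E s2 \<le> h s1 * E s1 - h' s1 * (J / V)"
    using hc J by simp
  with outer have "h s2 * E s2 \<le> h s * E s - h' s1 * (J / (2 * V))"
    using pars by (simp add: field_simps)
  moreover have "J \<ge> 0"
    unfolding J using F_le_0 g
    by (intro integral_nonneg integrable_continuous_interval) auto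
  then have "h' R * (J / (2 * V)) \<le> h' s1 * (J / (2 * V))"
    using h(3)[OF _ R1(1)] pars by (intro mult_right_mono) auto
  ultimately show ?thesis
    using hc cross[of s2] by (intro exI[of _ s2]) auto
qed

lemma well_integral_pos: "integral {bm..bp} (\<lambda>s. - F s) > 0"
proof -
  have int: "(\<lambda>s. - F s) integrable_on {x..y}" for x y
    by (intro integrable_continuous_interval continuous_intros continuous_on_subset[OF F_cont]) auto
  \<comment> \<open>Staying away from 0, where \<open>F\<close> vanishes, gives a strictly negative
    maximum by compactness.\<close>
  obtain x where x: "x \<in> {bp / 2..bp}" "\<And>y. y \<in> {bp / 2..bp} \<Longrightarrow> F y \<le> F x"
    using continuous_attains_sup[of "{bp / 2..bp}" F] continuous_on_subset[OF F_cont] b by auto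
  have "0 < (bp - bp / 2) * - F x"
    using F_neg[of x] x b by (intro mult_pos_pos) auto
  also have "\<dots> = integral {bp / 2..bp} (\<lambda>_. - F x)"
    using b by simp
  also have "\<dots> \<le> integral {bp / 2..bp} (\<lambda>s. - F s)"
    using x int by (intro integral_le) auto
  also have "\<dots> \<le> integral {bm..bp} (\<lambda>s. - F s)"
    using b F_le_0 int by (intro integral_subset_le) auto
  finally show ?thesis .
qed

text \<open>Each half cycle lowers \<open>h E\<close> by at least the fixed amount \<open>A\<close>,
  so it would become negative although both factors are positive.\<close>

lemma weighted_energy_contradiction:
  assumes h: "\<And>r. r \<ge> R \<Longrightarrow> (h has_real_derivative h' r) (at r)"
    "\<And>r. r \<ge> R \<Longrightarrow> a * h' r = h r * k r"
    "\<And>r s. R \<le> r \<Longrightarrow> r \<le> s \<Longrightarrow> h' r \<le> h' s" "h' R > 0" "\<And>r. r \<ge> R \<Longrightarrow> h r > 0"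
    and E_R: "E R * (2 * K / c) \<le> integral {bm..bp} (\<lambda>s. - F s) / (2 * V)"
  shows False
proof -
  define J where "J = integral {bm..bp} (\<lambda>s. - F s)"
  interpret refl: oscillation p "- bp" "- bm" a c K V C R "\<lambda>s. F (- s)" "\<lambda>r. - v r" "\<lambda>r. - v' r"
     "\<lambda>r. - w r" "\<lambda>r. - w' r" E k
    by (rule reflected)
  have J: "J = integral {- bp..- bm} (\<lambda>s. - F (- s))"
    using Henstock_Kurzweil_Integration.integral_reflect_real[of bp bm "\<lambda>s. - F s"] by (simp add: J_def)
  define A where "A = h' R * (J / (2 * V))"
  have "J > 0" using well_integral_pos unfolding J_def .
  then have "A > 0" using h(4) pars by (simp add: A_def)
  have J_R: "E R * (2 * K / c) \<le> J / (2 * V)"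
    using E_R unfolding J_def .
  obtain s0 where s0: "s0 \<ge> R" "v s0 = bm" "v' s0 < 0"
    using start by blast
  have iter: "\<exists>s\<ge>s0. v s = bm \<and> v' s < 0 \<and> h s * E s \<le> h s0 * E s0 - A * n" for n :: nat
  proof (induction n)
    case 0
    then show ?case using s0 by auto
  next
    case (Suc n)
    then obtain s where s: "s \<ge> s0" "v s = bm" "v' s < 0" "h s * E s \<le> h s0 * E s0 - A * n"
      by blast
    obtain s1 where s1: "s1 > s" "v s1 = bp" "v' s1 > 0" "h s1 * E s1 \<le> h s * E s - A"
      using half_cycle_weighted_loss[OF h(1-4) J_def J_R, of s] s(1-3) s0(1) unfolding A_def by fastforce
    have "R \<le> s1" using s(1) s0(1) s1(1) by simp
    then obtain s2 where s2: "s2 > s1" "v s2 = bm" "v' s2 < 0" "h s2 * E s2 \<le> h s1 * E s1 - A"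
      using refl.half_cycle_weighted_loss[OF h(1-4) J J_R, of s1] s1(2,3) unfolding A_def by auto
    then have "s0 \<le> s2" "h s2 * E s2 \<le> h s0 * E s0 - A * real (Suc n)"
      using s s1 \<open>A > 0\<close> by (simp_all add: distrib_left)
    then show ?case
      using s2 by blast
  qed
  obtain n :: nat where "real n > h s0 * E s0 / A"
    using reals_Archimedean2 by blast
  then have "A * n > h s0 * E s0"
    using \<open>A > 0\<close> by (simp add: field_simps)
  moreover obtain s where "s \<ge> s0" "h s * E s \<le> h s0 * E s0 - A * n"
    using iter by blast
  ultimately have "h s * E s < 0"
    by simp
  then show False
    using h(5)[of s] E_pos[of s] s0(1) \<open>s \<ge> s0\<close> by (simp add: mult_less_0_iff)
qed

section \<open>Bounded versus unbounded crossing times\<close>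

lemma oscillation_later: "R \<le> R1 \<Longrightarrow> oscillation p bm bp a c K V C R1 F v v' w w' E k"
  using p b F_cont F_0 R pars continuous_on_subset[OF v'_cont, of "{R1..}"] w_bound w'_upper w'_lower
    v'_bound E_eq k_ge E_pos late_above late_below v_deriv w_deriv E_deriv F_neg
  by unfold_locales auto

text \<open>Since \<open>E r > 0\<close>, the integrand is dominated away from 0 by
  \<open>\<bar>F s\<bar> powr (- 1 / p)\<close>, a majorant independent of \<open>r\<close>. It is
  integrable near 0 by hypothesis and continuous on the rest of the well.\<close>

lemma crossing_integral_bound_of_integrable:
  assumes "\<epsilon> > 0" "set_integrable lborel {-\<epsilon><..<\<epsilon>} (\<lambda>s. \<bar>F s\<bar> powr (- 1 / p))"
  shows "\<exists>I>0. \<forall>r\<ge>R. integral {bm..bp} (\<lambda>s. (E r - F s) powr (- 1 / p)) \<le> I"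
proof -
  let ?G = "\<lambda>s. \<bar>F s\<bar> powr (- 1 / p)"
  define \<delta> where "\<delta> = min (\<epsilon> / 2) (min (- bm) bp)"
  have \<delta>: "0 < \<delta>" "\<delta> < \<epsilon>" "bm \<le> - \<delta>" "\<delta> \<le> bp"
    using assms(1) b by (auto simp: \<delta>_def)
  have away: "?G integrable_on {x..y}" if "bm \<le> x" "y \<le> bp" "0 \<notin> {x..y}" for x y
  proof -
    have "F s \<noteq> 0" if "s \<in> {x..y}" for s
    proof -
      have "s \<noteq> 0" using that \<open>0 \<notin> {x..y}\<close> by metis
      then show ?thesis using F_neg[of s] that \<open>bm \<le> x\<close> \<open>y \<le> bp\<close> by auto
    qed
    then show ?thesis
      by (intro integrable_continuous_interval continuous_intros continuous_on_subset[OF F_cont]) auto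
  qed
  have "set_integrable lborel {-\<delta>..\<delta>} ?G"
    by (rule set_integrable_subset[OF assms(2)]) (use \<delta> in auto)
  then have "?G integrable_on {-\<delta>..\<delta>}"
    by (rule set_borel_integral_eq_integral)
  moreover have "?G integrable_on {bm..-\<delta>}" "?G integrable_on {\<delta>..bp}"
    by (rule away; use \<delta> in auto)+
  ultimately have G: "?G integrable_on {bm..bp}"
    using \<delta> Henstock_Kurzweil_Integration.integrable_combine[of bm "-\<delta>" \<delta> ?G]
      Henstock_Kurzweil_Integration.integrable_combine[of bm \<delta> bp ?G] by simp
  have "integral {bm..bp} (\<lambda>s. (E r - F s) powr (- 1 / p)) \<le> integral {bm..bp} ?G" if "r \<ge> R" for r
  proof -
    let ?g = "\<lambda>s. (E r - F s) powr (- 1 / p)"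
    \<comment> \<open>At 0 the majorant takes the default value \<open>0 powr _ = 0\<close>, so the
      pointwise comparison fails there; changing one value does not affect the integral.\<close>
    let ?G' = "\<lambda>s. if s = 0 then ?g 0 else ?G s"
    have pos: "E r - F s > 0" if "bm \<le> s" "s \<le> bp" for s
      using E_pos[OF \<open>r \<ge> R\<close>] F_le_0[OF that] by auto
    have g: "continuous_on {bm..bp} ?g"
      using pos by (intro continuous_intros continuous_on_subset[OF F_cont]) force+
    have "integral {bm..bp} ?g \<le> integral {bm..bp} ?G'"
    proof (rule integral_le)
      show "?g integrable_on {bm..bp}"
        using g by (rule integrable_continuous_interval)
      show "?G' integrable_on {bm..bp}"
        by (rule integrable_spike[OF G negligible_sing[of 0]]) auto
      fix s assume s: "s \<in> {bm..bp}"
      show "?g s \<le> ?G' s"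
      proof (cases "s = 0")
        case False
        then have "(E r - F s) powr (- (1 / p)) \<le> (- F s) powr (- (1 / p))"
          using F_neg[of s] E_pos[OF \<open>r \<ge> R\<close>] s p by (intro powr_mono2') auto
        then show ?thesis
          using False F_neg[of s] s by simp
      qed simp
    qed
    also have "\<dots> = integral {bm..bp} ?G"
      by (rule integral_spike[OF negligible_sing[of 0]]) auto
    finally show ?thesis .
  qed
  then have "\<forall>r\<ge>R. integral {bm..bp} (\<lambda>s. (E r - F s) powr (- 1 / p)) \<le> max 1 (integral {bm..bp} ?G)"
    by (simp add: le_max_iff_disj)
  then show ?thesis
    by (intro exI[of _ "max 1 (integral {bm..bp} ?G)"]) auto
qed

lemma crossing_integral_bound_of_energy:
  assumes "e > 0" "\<And>r. r \<ge> R \<Longrightarrow> e \<le> E r"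
  shows "\<exists>I>0. \<forall>r\<ge>R. integral {bm..bp} (\<lambda>s. (E r - F s) powr (- 1 / p)) \<le> I"
proof (intro exI conjI allI impI)
  show "(bp - bm) * e powr (- 1 / p) > 0"
    using b assms(1) by simp
  fix r assume "r \<ge> R"
  have ge: "e \<le> E r - F s" if "bm \<le> s" "s \<le> bp" for s
    using assms(2)[OF \<open>r \<ge> R\<close>] F_le_0[OF that] by auto
  have "continuous_on {bm..bp} (\<lambda>s. (E r - F s) powr (- 1 / p))"
    using ge assms(1) by (intro continuous_intros continuous_on_subset[OF F_cont]) force+
  then have "integral {bm..bp} (\<lambda>s. (E r - F s) powr (- 1 / p)) \<le> integral {bm..bp} (\<lambda>s. e powr (- 1 / p))"
  proof (intro integral_le integrable_continuous_interval)
    fix s assume "s \<in> {bm..bp}"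
    then have "(E r - F s) powr (- (1 / p)) \<le> e powr (- (1 / p))"
      using ge[of s] assms(1) p by (intro powr_mono2') auto
    then show "(E r - F s) powr (- 1 / p) \<le> e powr (- 1 / p)"
      by simp
  qed auto
  then show "integral {bm..bp} (\<lambda>s. (E r - F s) powr (- 1 / p)) \<le> (bp - bm) * e powr (- 1 / p)"
    using b by simp
qed

text \<open>If the crossing integrals are bounded, the harmonic series argument applies. Otherwise
  the integrability alternative fails, so a weight \<open>h\<close> exists, and \<open>E\<close> has
  no positive lower bound, so it is small from some \<open>R1\<close> on.\<close>

lemma no_late_oscillation:
  assumes "(\<exists>\<epsilon>>0. set_integrable lborel {-\<epsilon><..<\<epsilon>} (\<lambda>s. \<bar>F s\<bar> powr (- 1 / p))) \<or>
     (\<exists>h h'. \<forall>r\<ge>R. (h has_real_derivative h' r) (at r) \<and> a * h' r = h r * k r \<and>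
        h r > 0 \<and> h' r > 0 \<and> (\<forall>s\<ge>r. h' r \<le> h' s))"
  shows False
proof (cases "\<exists>I>0. \<forall>r\<ge>R. integral {bm..bp} (\<lambda>s. (E r - F s) powr (- 1 / p)) \<le> I")
  case True
  then show False
    using bounded_crossing_contradiction by blast
next
  case False
  then have "\<not> (\<exists>\<epsilon>>0. set_integrable lborel {-\<epsilon><..<\<epsilon>} (\<lambda>s. \<bar>F s\<bar> powr (- 1 / p)))"
    using crossing_integral_bound_of_integrable by metis
  then obtain h h' where hh: "\<forall>r\<ge>R. (h has_real_derivative h' r) (at r) \<and> a * h' r = h r * k r \<and>
        h r > 0 \<and> h' r > 0 \<and> (\<forall>s\<ge>r. h' r \<le> h' s)"
    using assms by metis
  then have h: "\<And>r. r \<ge> R \<Longrightarrow> (h has_real_derivative h' r) (at r)"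
    "\<And>r. r \<ge> R \<Longrightarrow> a * h' r = h r * k r" "\<And>r. r \<ge> R \<Longrightarrow> h r > 0" "\<And>r. r \<ge> R \<Longrightarrow> h' r > 0"
    "\<And>r s. R \<le> r \<Longrightarrow> r \<le> s \<Longrightarrow> h' r \<le> h' s"
    by auto
  define J where "J = integral {bm..bp} (\<lambda>s. - F s)"
  \<comment> \<open>This is the smallness needed for the weighted argument; the added 1 keeps the
    denominator positive when \<open>K = 0\<close>.\<close>
  define e where "e = J / (2 * V) / (2 * K / c + 1)"
  have "2 * K / c \<ge> 0" using pars by simp
  have "J > 0" using well_integral_pos unfolding J_def .
  then have "e > 0"
    unfolding e_def using \<open>2 * K / c \<ge> 0\<close> pars
    by (intro divide_pos_pos mult_pos_pos add_nonneg_pos) auto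
  then obtain R1 where R1: "R1 \<ge> R" "E R1 < e"
    using crossing_integral_bound_of_energy[of e] False by force
  interpret late: oscillation p bm bp a c K V C R1 F v v' w w' E k
    using R1(1) by (rule oscillation_later)
  have "E R1 * (2 * K / c) \<le> e * (2 * K / c + 1)"
    using R1(2) E_pos[OF R1(1)] \<open>2 * K / c \<ge> 0\<close> by (intro mult_mono) auto
  also have "\<dots> = J / (2 * V)"
    using \<open>2 * K / c \<ge> 0\<close> by (simp add: e_def)
  finally show False
    using late.weighted_energy_contradiction[of h h'] h R1(1) unfolding J_def by simp
qed

end

section \<open>Sign changes do not accumulate\<close>

text \<open>Here late oscillation is to be derived, so no positivity of \<open>E\<close> is assumed.
  At 0 only continuity of \<open>v\<close> is required.\<close>

locale dissipative =
  fixes p \<beta>m \<beta>p a V :: real and F v v' E :: "real \<Rightarrow> real"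
  assumes p: "p > 1" and \<beta>: "\<beta>m < 0" "0 < \<beta>p"
    and F_neg: "\<And>s. \<beta>m < s \<Longrightarrow> s < \<beta>p \<Longrightarrow> s \<noteq> 0 \<Longrightarrow> F s < 0"
    and F_0: "F 0 = 0"
    and a: "a > 0" and V: "V > 0"
    and v_cont: "continuous_on {0..} v"
    and v_deriv: "\<And>r. r > 0 \<Longrightarrow> (v has_real_derivative v' r) (at r)"
    and v'_bound: "\<And>r. r > 0 \<Longrightarrow> \<bar>v' r\<bar> \<le> V"
    and E_eq: "\<And>r. r > 0 \<Longrightarrow> E r = a * \<bar>v' r\<bar> powr p + F (v r)"
    and E_antimono: "\<And>r s. 0 < r \<Longrightarrow> r \<le> s \<Longrightarrow> E s \<le> E r"
begin

lemma reflected: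
  "dissipative p (- \<beta>p) (- \<beta>m) a V (\<lambda>s. F (- s)) (\<lambda>r. - v r) (\<lambda>r. - v' r) E"
  using p \<beta> F_0 a V v'_bound E_eq E_antimono
  by unfold_locales
    (auto intro!: derivative_eq_intros v_deriv F_neg continuous_intros v_cont
      simp: less_minus_iff minus_less_iff)

lemma E_zero_nonneg: "r > 0 \<Longrightarrow> v r = 0 \<Longrightarrow> E r \<ge> 0"
  using E_eq[of r] a F_0 by simp

text \<open>Let \<open>m\<close> maximise \<open>v\<close> between \<open>t0\<close> and a zero
  \<open>z\<close> after \<open>t1\<close>. There \<open>v' m = 0\<close>, so
  \<open>F (v m) = E m \<ge> E z \<ge> 0\<close> and the peak is beyond the well. Climbing to it at
  speed at most \<open>V\<close> takes time at least \<open>\<beta>p / V\<close>.\<close>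

lemma peak_above:
  assumes t: "0 \<le> t0" "t0 < t1" "t1 < t2" "v t0 < 0" "v t1 > 0" "v t2 < 0"
  obtains m where "t0 < m" "m < t2" "v m \<ge> \<beta>p" "t2 - t0 \<ge> \<beta>p / V"
proof -
  have cont: "continuous_on {x..y} v" if "x \<ge> 0" for x y
    using that by (auto intro: continuous_on_subset[OF v_cont])
  obtain z where z: "t1 \<le> z" "z \<le> t2" "v z = 0"
    using IVT2'[of v t2 0 t1] t cont[of t1 t2] by auto
  have "z < t2" using z t by (cases "z = t2") auto
  obtain m where m: "m \<in> {t0..z}" "\<And>x. x \<in> {t0..z} \<Longrightarrow> v x \<le> v m"
    using continuous_attains_sup[of "{t0..z}" v] cont[of t0 z] z t by auto
  have "v m > 0" using m(2)[of t1] z t by simp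
  have mi: "t0 < m" "m < z"
    using m(1) \<open>v m > 0\<close> z t by (auto simp: less_le)
  have "v' m = 0"
  proof (rule DERIV_local_max[OF v_deriv])
    show "\<forall>y. \<bar>m - y\<bar> < min (m - t0) (z - m) \<longrightarrow> v y \<le> v m"
      using m(2) by (auto simp: abs_less_iff)
  qed (use mi t in auto)
  then have "F (v m) = E m"
    using E_eq[of m] mi t by simp
  also have "\<dots> \<ge> 0"
    using E_antimono[of m z] E_zero_nonneg[of z] z mi t by simp
  finally have "v m \<ge> \<beta>p"
    using F_neg[of "v m"] \<open>v m > 0\<close> \<beta> by force
  have "v differentiable (at x)" if "t0 < x" for x
    using v_deriv[of x] t(1) that by (auto simp: real_differentiable_def)
  then obtain l x where "t0 < x" "x < m" "(v has_real_derivative l) (at x)" "v m - v t0 = (m - t0) * l"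
    using MVT[OF mi(1) cont[OF t(1)]] by blast
  moreover have "l = v' x" "x > 0"
    using DERIV_unique v_deriv[of x] calculation t(1) by auto
  ultimately have "v m - v t0 \<le> (m - t0) * V"
    using v'_bound[of x] mi by (auto intro!: mult_left_mono)
  then have "\<beta>p \<le> (m - t0) * V"
    using \<open>v m \<ge> \<beta>p\<close> t by simp
  then have "\<beta>p / V \<le> m - t0"
    using V by (simp add: field_simps)
  then show ?thesis
    using that[OF mi(1) _ \<open>v m \<ge> \<beta>p\<close>] mi \<open>z < t2\<close> by simp
qed

lemma peak:
  assumes t: "0 \<le> t0" "t0 < t1" "t1 < t2" "v t0 * v t1 < 0" "v t1 * v t2 < 0"
  obtains m where "t0 < m" "m < t2" "v t1 > 0 \<Longrightarrow> v m \<ge> \<beta>p" "v t1 < 0 \<Longrightarrow> v m \<le> \<beta>m"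
    "t2 - t0 \<ge> min \<beta>p (- \<beta>m) / V"
proof (cases "v t1 > 0")
  case True
  then have "v t0 < 0" "v t2 < 0" using t by (auto simp: mult_less_0_iff)
  then obtain m where m: "t0 < m" "m < t2" "v m \<ge> \<beta>p" "t2 - t0 \<ge> \<beta>p / V"
    using peak_above[of t0 t1 t2] t True by blast
  have "min \<beta>p (- \<beta>m) / V \<le> \<beta>p / V" using V by (intro divide_right_mono) auto
  then show ?thesis using that[OF m(1,2)] m True by simp
next
  case False
  interpret refl: dissipative p "- \<beta>p" "- \<beta>m" a V "\<lambda>s. F (- s)" "\<lambda>r. - v r" "\<lambda>r. - v' r" E
    by (rule reflected)
  have "v t1 < 0" "v t0 > 0" "v t2 > 0" using False t by (auto simp: mult_less_0_iff)
  then obtain m where m: "t0 < m" "m < t2" "- v m \<ge> - \<beta>m" "t2 - t0 \<ge> - \<beta>m / V"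
    using refl.peak_above[of t0 t1 t2] t by auto
  have "min \<beta>p (- \<beta>m) / V \<le> - \<beta>m / V" using V by (intro divide_right_mono) auto
  then show ?thesis using that[OF m(1,2)] m False by simp
qed

lemma late_peaks:
  assumes chains: "\<And>n. \<exists>t :: nat \<Rightarrow> real. (\<forall>i\<le>n. t i \<in> {0..}) \<and>
        (\<forall>i<n. t i < t (Suc i) \<and> v (t i) * v (t (Suc i)) < 0)"
  shows "\<exists>x\<ge>T. v x \<ge> \<beta>p" "\<exists>x\<ge>T. v x \<le> \<beta>m"
proof -
  define d where "d = min \<beta>p (- \<beta>m) / V"
  have "d > 0" using \<beta> V by (simp add: d_def)
  \<comment> \<open>Every two sign changes take time at least \<open>d\<close>, so the point with
    index \<open>2 * N\<close> is past \<open>T\<close>. Three further points allow two consecutive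
    peaks, one on each side of the well.\<close>
  obtain N :: nat where N: "T / d \<le> real N"
    using real_arch_simple by blast
  obtain t where t: "\<And>i. i \<le> 2 * N + 3 \<Longrightarrow> t i \<ge> 0"
    "\<And>i. i < 2 * N + 3 \<Longrightarrow> t i < t (Suc i)" "\<And>i. i < 2 * N + 3 \<Longrightarrow> v (t i) * v (t (Suc i)) < 0"
    using chains[of "2 * N + 3"] by auto
  have gap: "t (Suc (Suc i)) - t i \<ge> d" if "Suc i < 2 * N + 3" for i
    unfolding d_def by (rule peak[of "t i" "t (Suc i)" "t (Suc (Suc i))"]) (use t that in auto)
  have "t (2 * j) \<ge> j * d" if "j \<le> N" for j
    using that
  proof (induction j)
    case (Suc j)
    then show ?case
      using gap[of "2 * j"] by (simp add: algebra_simps)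
  qed (use t(1) in simp)
  then have T: "T \<le> t (2 * N)"
    using N \<open>d > 0\<close> by (force simp: field_simps)
  have *: "\<exists>m\<ge>T. (v (t (Suc i)) > 0 \<longrightarrow> v m \<ge> \<beta>p) \<and> (v (t (Suc i)) < 0 \<longrightarrow> v m \<le> \<beta>m)"
    if i: "i = 2 * N \<or> i = Suc (2 * N)" for i
  proof -
    have "T \<le> t i"
      using T t(2)[of "2 * N"] i by auto
    moreover obtain m where "t i < m" "v (t (Suc i)) > 0 \<Longrightarrow> v m \<ge> \<beta>p"
      "v (t (Suc i)) < 0 \<Longrightarrow> v m \<le> \<beta>m"
      by (rule peak[of "t i" "t (Suc i)" "t (Suc (Suc i))"]) (use t i in auto)
    ultimately show ?thesis by (intro exI[of _ m]) auto
  qed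
  have "v (t (Suc (2 * N))) * v (t (Suc (Suc (2 * N)))) < 0"
    using t(3)[of "Suc (2 * N)"] by simp
  then show "\<exists>x\<ge>T. v x \<ge> \<beta>p" "\<exists>x\<ge>T. v x \<le> \<beta>m"
    using *[of "2 * N"] *[of "Suc (2 * N)"] by (auto simp: mult_less_0_iff)
qed

end

lemma sign_changes_infinite_imp_chains:
  assumes "\<not> sign_changes S v < \<infinity>"
  shows "\<exists>t :: nat \<Rightarrow> real. (\<forall>i\<le>n. t i \<in> S) \<and> (\<forall>i<n. t i < t (Suc i) \<and> v (t i) * v (t (Suc i)) < 0)"
proof (rule ccontr)
  assume none: "\<nexists>t :: nat \<Rightarrow> real. (\<forall>i\<le>n. t i \<in> S) \<and>
    (\<forall>i<n. t i < t (Suc i) \<and> v (t i) * v (t (Suc i)) < 0)"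
  have "sign_changes S v \<le> enat n"
    unfolding sign_changes_def
  proof (rule Sup_least, clarify)
    fix m and t :: "nat \<Rightarrow> real"
    assume m: "\<forall>i\<le>m. t i \<in> S" "\<forall>i<m. t i < t (Suc i) \<and> v (t i) * v (t (Suc i)) < 0"
    \<comment> \<open>An initial segment of a longer chain would be a chain of length
      \<open>n\<close>.\<close>
    have "m < n"
    proof (rule ccontr)
      assume "\<not> m < n"
      then show False
        using none m by (meson less_le_trans not_less order_trans)
    qed
    then show "enat m \<le> enat n" by simp
  qed
  then show False
    using assms by (simp add: order.strict_trans1[of _ "enat n"])
qed

section \<open>The differential equation\<close>

lemma C1_differentiable_on_imp_DERIV_deriv:
  fixes g :: "real \<Rightarrow> real"
  assumes "g C1_differentiable_on S" "x \<in> S"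
  shows "(g has_real_derivative deriv g x) (at x)"
  using assms
  by (metis C1_differentiable_on_def DERIV_imp_deriv has_real_derivative_iff_has_vector_derivative)

text \<open>Positivity at \<open>\<beta>\<close> persists nearby. The well can thus be shrunk
  slightly, so that positivity of \<open>f\<close> already holds from its new edge on.\<close>

lemma pos_extends_left:
  fixes f :: "real \<Rightarrow> real"
  assumes "continuous_on UNIV f" "0 < \<beta>" "\<forall>s\<ge>\<beta>. f s > 0"
  obtains b where "0 < b" "b < \<beta>" "\<And>s. b \<le> s \<Longrightarrow> f s > 0"
proof -
  have "open {s. f s > 0}"
    using assms(1) by (intro open_Collect_less) auto
  then obtain d where d: "d > 0" "ball \<beta> d \<subseteq> {s. f s > 0}"
    using assms(3) open_contains_ball by (metis mem_Collect_eq order_refl)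
  define b where "b = max (\<beta> / 2) (\<beta> - d / 2)"
  have "f s > 0" if "b \<le> s" for s
  proof (cases "s \<ge> \<beta>")
    case False
    then have "s \<in> ball \<beta> d"
      using that d(1) by (auto simp: b_def dist_real_def)
    then show ?thesis using d(2) by auto
  qed (use assms(3) in simp)
  moreover have "0 < b" "b < \<beta>" using assms(2) d(1) by (auto simp: b_def)
  ultimately show ?thesis using that by blast
qed

lemma compact_interval_pos_lower_bound:
  fixes f :: "real \<Rightarrow> real"
  assumes "continuous_on {x..y} f" "\<And>s. s \<in> {x..y} \<Longrightarrow> f s > 0"
  obtains c where "c > 0" "\<And>s. s \<in> {x..y} \<Longrightarrow> c \<le> f s"
proof (cases "x \<le> y")
  case True
  then obtain z where "z \<in> {x..y}" "\<And>s. s \<in> {x..y} \<Longrightarrow> f z \<le> f s"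
    using continuous_attains_inf[of "{x..y}" f] assms(1) by auto
  then show ?thesis using that assms(2) by blast
next
  case False
  then show ?thesis using that[of 1] by auto
qed

text \<open>Beyond \<open>\<beta>\<close> the potential increases strictly, so its limit
  \<open>L\<close> exceeds \<open>F x\<close>. As the same \<open>L\<close> is the limit at the
  other end, \<open>F\<close> exceeds \<open>F x\<close> near both ends.\<close>

lemma sublevel_bounded:
  fixes F f :: "real \<Rightarrow> real" and L :: ereal
  assumes deriv: "\<And>s. (F has_real_derivative f s) (at s)"
    and \<beta>: "0 < \<beta>" "F \<beta> = 0" "\<forall>s\<in>{0<..<\<beta>}. F s < 0" "\<forall>s\<ge>\<beta>. f s > 0"
    and lim: "((\<lambda>s. ereal (F s)) \<longlongrightarrow> L) at_top" "((\<lambda>s. ereal (F s)) \<longlongrightarrow> L) at_bot"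
    and "x > 0"
  obtains M where "\<And>s. F s \<le> F x \<Longrightarrow> \<bar>s\<bar> \<le> M"
proof -
  have mono: "F y < F z" if "\<beta> \<le> y" "y < z" for y z
    using DERIV_pos_imp_increasing[OF that(2), of F] deriv \<beta>(4) that(1) by (meson order_trans)
  define s0 where "s0 = max x \<beta> + 1"
  have "F x \<le> F (max x \<beta>)"
    using \<beta>(2,3) \<open>x > 0\<close> by (cases "x < \<beta>") (auto simp: max_def intro: less_imp_le)
  also have "\<dots> < F s0"
    by (rule mono) (auto simp: s0_def)
  finally have "F x < F s0" .
  have "eventually (\<lambda>s. ereal (F s0) \<le> ereal (F s)) at_top"
    using eventually_gt_at_top[of s0]
  proof eventually_elim
    case (elim s)
    then show ?case using mono[of s0 s] by (auto simp: s0_def less_imp_le)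
  qed
  then have "ereal (F s0) \<le> L"
    by (rule tendsto_lowerbound[OF lim(1)]) simp
  then have "ereal (F x) < L"
    using \<open>F x < F s0\<close> by (meson ereal_less_eq(3) less_ereal.simps(1) order_less_le_trans)
  then have "eventually (\<lambda>s. ereal (F x) < ereal (F s)) at_top"
    "eventually (\<lambda>s. ereal (F x) < ereal (F s)) at_bot"
    using lim by (auto dest: order_tendstoD(1))
  then obtain A B where "\<And>s. s \<ge> A \<Longrightarrow> F x < F s" "\<And>s. s \<le> B \<Longrightarrow> F x < F s"
    unfolding eventually_at_top_linorder eventually_at_bot_linorder by auto
  then have "\<bar>s\<bar> \<le> max \<bar>A\<bar> \<bar>B\<bar>" if "F s \<le> F x" for s
    using that by (smt (verit))
  then show ?thesis using that by blast
qed

theorem theorem3p5: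
  fixes p p' \<beta>m \<beta>p lam :: real
    and f q v :: "real \<Rightarrow> real"
  assumes p: "p > 1" and p': "p' = p / (p - 1)"
    and f_cont: "continuous_on UNIV f"
    and f_lip: "local_lipschitz (UNIV :: real set) (UNIV - {0}) (\<lambda>_. f)"
    and f_0: "f 0 = 0"
    and beta: "\<beta>m < 0" "0 < \<beta>p"
    and F_neg: "\<forall>s\<in>{\<beta>m<..<\<beta>p} - {0}. primitive f s < 0"
    and F_beta: "primitive f \<beta>m = 0" "primitive f \<beta>p = 0"
    and f_pos: "\<forall>s\<ge>\<beta>p. f s > 0"
    and f_neg: "\<forall>s\<le>\<beta>m. f s < 0"
    and F_infty: "\<exists>L :: ereal. ((\<lambda>s. ereal (primitive f s)) \<longlongrightarrow> L) at_top \<and>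
                               ((\<lambda>s. ereal (primitive f s)) \<longlongrightarrow> L) at_bot"
    and q_pos: "\<forall>r>0. q r > 0"
    and q_C1: "q C1_differentiable_on {0<..}"
    and q'_pos: "\<forall>r>0. deriv q r > 0"
    and q'_q: "strict_antimono_on {0<..} (\<lambda>r. deriv q r / q r)"
    and q_growth: "\<exists>C1>0. \<exists>C2>0. \<forall>r>0. C1 \<le> r * deriv q r / q r \<and> r * deriv q r / q r \<le> C2"
    and alt: "(\<exists>\<epsilon>>0. set_integrable lborel {-\<epsilon><..<\<epsilon>} (\<lambda>s. \<bar>primitive f s\<bar> powr (- 1 / p))) \<or>
              (mono_on {0<..} (deriv (\<lambda>r. q r powr p')) \<and>
               filterlim (deriv (\<lambda>r. q r powr p')) at_top at_top)"
    and lam: "lam > 0"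
    and sol: "is_solution p q f lam v"
  shows "sign_changes {0..} v < \<infinity>"
proof (rule ccontr)
  assume "\<not> sign_changes {0..} v < \<infinity>"
  note chains = sign_changes_infinite_imp_chains[OF this]
  obtain v' where v_deriv0: "\<And>r. r \<ge> 0 \<Longrightarrow> (v has_real_derivative v' r) (at r within {0..})"
    and v'_cont: "continuous_on {0..} v'"
    and w_C1: "(\<lambda>r. q r * phi p (v' r)) C1_differentiable_on {0<..}"
    and ode: "\<And>r. r > 0 \<Longrightarrow> deriv (\<lambda>r. q r * phi p (v' r)) r = - (q r * f (v r))"
    and v0: "v 0 = lam" "v' 0 = 0"
    using sol unfolding is_solution_def by (auto simp: eq_neg_iff_add_eq_0)
  obtain C1 C2 where C: "C1 > 0" "C2 > 0" "\<And>r. r > 0 \<Longrightarrow> C1 \<le> r * deriv q r / q r"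
    "\<And>r. r > 0 \<Longrightarrow> r * deriv q r / q r \<le> C2"
    using q_growth by blast
  obtain L :: ereal where L: "((\<lambda>s. ereal (primitive f s)) \<longlongrightarrow> L) at_top"
    "((\<lambda>s. ereal (primitive f s)) \<longlongrightarrow> L) at_bot"
    using F_infty by blast
  define F where "F = primitive f"
  define k where "k r = deriv q r / q r" for r
  define a where "a = 1 / p'"
  define E where "E r = a * \<bar>v' r\<bar> powr p + F (v r)" for r
  have p'_gt: "p' > 1" using p unfolding p' by (simp add: field_simps)
  have a_bounds: "0 < a" "a \<le> 1" using p'_gt by (auto simp: a_def)
  have F_deriv: "(F has_real_derivative f s) (at s)" for s
    unfolding F_def by (rule primitive_deriv[OF f_cont])
  have F_cont: "continuous_on UNIV F"
    by (meson DERIV_isCont F_deriv continuous_at_imp_continuous_on)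
  have F_0: "F 0 = 0" by (simp add: F_def primitive_0)
  have v_deriv: "(v has_real_derivative v' r) (at r)" if "r > 0" for r
    using v_deriv0[of r] that at_within_interior[of r "{0..}"] by simp
  have v_cont: "continuous_on {0..} v"
    by (rule DERIV_continuous_on[of _ _ v']) (use v_deriv0 in auto)
  have q_deriv: "(q has_real_derivative deriv q r) (at r)" if "r > 0" for r
    using C1_differentiable_on_imp_DERIV_deriv[OF q_C1] that by simp
  \<comment> \<open>Only the product with \<open>q\<close> is differentiable by assumption; dividing
    by the positive function \<open>q\<close> exposes the friction coefficient
    \<open>k\<close>.\<close>
  have phi_deriv: "((\<lambda>r. phi p (v' r)) has_real_derivative - f (v r) - k r * phi p (v' r)) (at r)"
    if r: "r > 0" for r
  proof (rule has_field_derivative_transform_within_open[of "\<lambda>r. q r * phi p (v' r) / q r" _ _ "{0<..}"])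
    have w: "((\<lambda>r. q r * phi p (v' r)) has_real_derivative - (q r * f (v r))) (at r)"
      using C1_differentiable_on_imp_DERIV_deriv[OF w_C1, of r] ode[OF r] r by simp
    have "q r \<noteq> 0" using q_pos r by force
    then have eq: "(- (q r * f (v r)) * q r - q r * phi p (v' r) * deriv q r) / (q r * q r)
        = - f (v r) - k r * phi p (v' r)"
      by (simp add: k_def field_simps)
    show "((\<lambda>r. q r * phi p (v' r) / q r) has_real_derivative - f (v r) - k r * phi p (v' r)) (at r)"
      using DERIV_divide[OF w q_deriv[OF r] \<open>q r \<noteq> 0\<close>] unfolding eq .
  qed (use r q_pos in \<open>auto simp: less_le\<close>)
  \<comment> \<open>The kinetic term is rewritten through \<open>phi p (v' r)\<close> before
    differentiating; the terms \<open>f (v r) * v' r\<close> cancel because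
    \<open>a * p' = 1\<close>.\<close>
  have E_deriv: "(E has_real_derivative - (k r * \<bar>v' r\<bar> powr p)) (at r)" if r: "r > 0" for r
  proof -
    have "((\<lambda>r. a * \<bar>phi p (v' r)\<bar> powr p' + F (v r)) has_real_derivative
        a * (p' * phi p' (phi p (v' r)) * (- f (v r) - k r * phi p (v' r))) + f (v r) * v' r) (at r)"
      by (intro DERIV_add DERIV_cmult DERIV_chain2[OF deriv_abs_powr[OF p'_gt] phi_deriv[OF r]]
          DERIV_chain2[OF F_deriv v_deriv[OF r]])
    moreover have "\<bar>phi p (v' r)\<bar> powr p' = \<bar>v' r\<bar> powr p" for r
      using abs_phi_powr_conjugate[OF p] p' by simp
    moreover have "phi p' (phi p (v' r)) = v' r"
      using phi_conjugate[OF p] p' by simp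
    moreover have "a * (p' * v' r * (- f (v r) - k r * phi p (v' r))) + f (v r) * v' r
        = - (k r * (phi p (v' r) * v' r))"
      using p'_gt by (simp add: a_def algebra_simps)
    ultimately show ?thesis
      by (simp add: phi_mult_self E_def[abs_def])
  qed
  have k_bounds: "C1 / r \<le> k r" "k r \<le> C2 / r" if "r > 0" for r
    using C(3,4)[OF that] that by (simp_all add: k_def field_simps)
  have k_nonneg: "k r \<ge> 0" if "r > 0" for r
    using k_bounds(1)[OF that] C(1) that by (meson divide_nonneg_pos less_imp_le order_trans)
  have E_cont: "continuous_on {0..} E"
    unfolding E_def using p
    by (intro continuous_on_add continuous_on_mult continuous_on_powr' continuous_on_rabs
        continuous_on_const v'_cont v_cont continuous_on_compose2[OF F_cont]) auto
  have E_antimono: "E s \<le> E r" if "0 \<le> r" "r \<le> s" for r s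
  proof (rule DERIV_nonpos_imp_decreasing_open[OF that(2)])
    fix x assume "r < x" "x < s"
    then show "\<exists>y. (E has_real_derivative y) (at x) \<and> y \<le> 0"
      using E_deriv[of x] k_nonneg[of x] that by (intro exI conjI) auto
  qed (use that in \<open>auto intro: continuous_on_subset[OF E_cont]\<close>)
  have E0: "E 0 = F lam" by (simp add: E_def v0)
  obtain M where M: "\<And>s. F s \<le> F lam \<Longrightarrow> \<bar>s\<bar> \<le> M"
    using sublevel_bounded[of F f \<beta>p L lam] F_deriv beta F_beta(2) F_neg f_pos L lam
    unfolding F_def by auto
  have v_bound: "\<bar>v r\<bar> \<le> M" if "r \<ge> 0" for r
  proof (rule M)
    have "F (v r) \<le> E r" using a_bounds by (simp add: E_def)
    then show "F (v r) \<le> F lam" using E_antimono[of 0 r] E0 that by simp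
  qed
  have "M \<ge> 0" using v_bound[of 0] by simp
  obtain m where m: "\<forall>s\<in>{-M..M}. F m \<le> F s"
    using continuous_attains_inf[of "{-M..M}" F] continuous_on_subset[OF F_cont] \<open>M \<ge> 0\<close> by auto
  \<comment> \<open>From \<open>a * \<bar>v' r\<bar> powr p = E r - F (v r)\<close>, bounded by
    \<open>F lam\<close> minus the minimum of \<open>F\<close> on the range of \<open>v\<close>; the
    added 1 makes \<open>V\<close> strictly positive.\<close>
  define V where "V = ((F lam - F m) / a) powr (1 / p) + 1"
  have V: "V > 0" by (simp add: V_def add_nonneg_pos)
  have v'_bound: "\<bar>v' r\<bar> \<le> V" if "r \<ge> 0" for r
  proof -
    have "F m \<le> F (v r)"
      using m v_bound[OF that] by (auto simp: abs_le_iff)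
    then have "\<bar>v' r\<bar> powr p \<le> (F lam - F m) / a"
      using E_antimono[of 0 r] E0 that a_bounds by (simp add: E_def field_simps)
    then have "(\<bar>v' r\<bar> powr p) powr (1 / p) \<le> ((F lam - F m) / a) powr (1 / p)"
      using p by (intro powr_mono2) auto
    then show ?thesis using p by (simp add: V_def powr_powr)
  qed
  interpret dissipative p \<beta>m \<beta>p a V F v v' E
    using p beta F_neg F_0 a_bounds V v_cont v_deriv v'_bound E_antimono
    by unfold_locales (auto simp: E_def F_def)
  note late = late_peaks[OF chains]
  obtain bp where bp: "0 < bp" "bp < \<beta>p" "\<And>s. bp \<le> s \<Longrightarrow> f s > 0"
    using pos_extends_left[OF f_cont beta(2) f_pos] by blast
  have f_refl_cont: "continuous_on S (\<lambda>s. - f (- s))" for S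
    by (intro continuous_intros continuous_on_compose2[OF f_cont]) auto
  obtain b where b: "0 < b" "b < - \<beta>m" "\<And>s. b \<le> s \<Longrightarrow> - f (- s) > 0"
    using pos_extends_left[of "\<lambda>s. - f (- s)" "- \<beta>m"] f_neg beta(1) f_refl_cont by auto
  have late_above: "\<exists>t\<ge>T. v t > bp" and late_below: "\<exists>t\<ge>T. v t < - b" for T
    using late[of T] bp(2) b(2) by (meson less_le_trans le_less_trans minus_less_iff less_minus_iff)+
  \<comment> \<open>Late oscillation supplies a zero of \<open>v\<close> after \<open>r\<close>, and
    the energy there is nonnegative.\<close>
  have E_nonneg: "E r \<ge> 0" if "r > 0" for r
  proof -
    obtain t1 where t1: "t1 \<ge> r" "v t1 > bp" using late_above by blast
    obtain t2 where t2: "t2 \<ge> t1" "v t2 < - b" using late_below by blast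
    have "0 \<le> t1" using t1 \<open>r > 0\<close> by simp
    then obtain z where "t1 \<le> z" "z \<le> t2" "v z = 0"
      using IVT2'[of v t2 0 t1] t1 t2 bp(1) b(1) continuous_on_subset[OF v_cont, of "{t1..t2}"] by auto
    then show ?thesis
      using E_zero_nonneg[of z] E_antimono[of r z] t1 \<open>r > 0\<close> by simp
  qed
  \<comment> \<open>If the energy reached 0 it would stay 0; as \<open>k\<close> is positive,
    \<open>v'\<close> would vanish from then on, contradicting oscillation.\<close>
  have E_pos: "E r > 0" if "r > 0" for r
  proof (rule ccontr)
    assume "\<not> E r > 0"
    then have E_zero: "E s = 0" if "s \<ge> r" for s
      using E_nonneg[of s] E_antimono[of r s] that \<open>r > 0\<close> by simp
    have v'_zero: "v' s = 0" if "s > r" for s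
    proof -
      have "(E has_real_derivative 0) (at s)"
        by (rule has_field_derivative_transform_within_open[of "\<lambda>_. 0" _ _ "{r<..}"])
          (use that E_zero in auto)
      then have "k s * \<bar>v' s\<bar> powr p = 0"
        using DERIV_unique[OF E_deriv[of s]] that \<open>r > 0\<close> by force
      moreover have "k s > 0"
        using q_pos q'_pos that \<open>r > 0\<close> by (simp add: k_def)
      ultimately show ?thesis by simp
    qed
    obtain t1 where t1: "t1 \<ge> r + 1" "v t1 > bp" using late_above by blast
    obtain t2 where t2: "t2 \<ge> t1" "v t2 < - b" using late_below by blast
    have "t1 < t2" using t1 t2 bp b by (cases "t1 = t2") auto
    then obtain x where "t1 < x" "v t2 - v t1 = (t2 - t1) * v' x"
      using MVT2[of t1 t2 v v'] v_deriv t1(1) \<open>r > 0\<close> by auto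
    then show False
      using v'_zero[of x] t1 t2 bp b by simp
  qed
  obtain c1 where c1: "c1 > 0" "\<And>s. s \<in> {bp..M} \<Longrightarrow> c1 \<le> f s"
    using compact_interval_pos_lower_bound[of bp M f] bp(3) continuous_on_subset[OF f_cont] by auto
  obtain c2 where c2: "c2 > 0" "\<And>s. s \<in> {b..M} \<Longrightarrow> c2 \<le> - f (- s)"
    using compact_interval_pos_lower_bound[of b M "\<lambda>s. - f (- s)"] b(3) f_refl_cont by auto
  \<comment> \<open>Outside the shrunken well the force has size at least \<open>2 * c\<close>. Half
    of it absorbs the friction, which is at most \<open>C2 / r * K \<le> c\<close> for
    \<open>r \<ge> R\<close>.\<close>
  define c where "c = min c1 c2 / 2"
  define K where "K = V powr (p - 1)"
  define R where "R = max 1 (C2 * K / c)"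
  have c: "c > 0" using c1(1) c2(1) by (simp add: c_def)
  have K: "K \<ge> 0" by (simp add: K_def)
  have R: "R \<ge> 1" "R > 0" by (auto simp: R_def)
  have phi_bound: "\<bar>phi p (v' r)\<bar> \<le> K" if "r \<ge> R" for r
    unfolding abs_phi K_def using v'_bound[of r] that R p by (intro powr_mono2) auto
  have friction: "\<bar>k r * phi p (v' r)\<bar> \<le> c" if "r \<ge> R" for r
  proof -
    have "r > 0" "C2 * K / c \<le> r" using that R by (auto simp: R_def)
    have "\<bar>k r * phi p (v' r)\<bar> = k r * \<bar>phi p (v' r)\<bar>"
      using k_nonneg[OF \<open>r > 0\<close>] by (simp add: abs_mult)
    also have "\<dots> \<le> C2 / r * K"
      using k_bounds(2)[OF \<open>r > 0\<close>] phi_bound[OF that] C(2) \<open>r > 0\<close> by (intro mult_mono) auto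
    also have "\<dots> \<le> c"
      using \<open>C2 * K / c \<le> r\<close> \<open>r > 0\<close> c by (simp add: field_simps)
    finally show ?thesis .
  qed
  interpret oscillation p "- b" bp a c K V C1 R F v v' "\<lambda>r. phi p (v' r)"
    "\<lambda>r. - f (v r) - k r * phi p (v' r)" E k
  proof
    show "continuous_on {R..} v'" using R by (auto intro: continuous_on_subset[OF v'_cont])
    show "F s < 0" if "- b \<le> s" "s \<le> bp" "s \<noteq> 0" for s
      using F_neg that bp(2) b(2) by (auto simp: F_def)
    fix r assume r: "r \<ge> R"
    then have "r \<ge> 0" using R by simp
    show "- f (v r) - k r * phi p (v' r) \<le> - c" if "v r \<ge> bp"
      using c1(2)[of "v r"] that v_bound[OF \<open>r \<ge> 0\<close>] friction[OF r] by (auto simp: c_def abs_le_iff min_def split: if_splits)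
    show "c \<le> - f (v r) - k r * phi p (v' r)" if "v r \<le> - b"
      using c2(2)[of "- v r"] that v_bound[OF \<open>r \<ge> 0\<close>] friction[OF r] by (auto simp: c_def abs_le_iff min_def split: if_splits)
  qed (use p b bp F_cont F_0 R a_bounds c C(1) V K v_deriv phi_deriv phi_bound v'_bound E_deriv k_bounds(1)
      E_pos late_above late_below in \<open>auto simp: E_def\<close>)
  \<comment> \<open>The weight is \<open>q powr p'\<close>: its logarithmic derivative is
    \<open>p' * k\<close>, which matches the required relation because
    \<open>a = 1 / p'\<close>.\<close>
  have "\<exists>h h'. \<forall>r\<ge>R. (h has_real_derivative h' r) (at r) \<and> a * h' r = h r * k r \<and>
        h r > 0 \<and> h' r > 0 \<and> (\<forall>s\<ge>r. h' r \<le> h' s)"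
    if mono: "mono_on {0<..} (deriv (\<lambda>r. q r powr p'))"
  proof (intro exI allI impI conjI)
    let ?h = "\<lambda>r. q r powr p'"
    fix r assume "r \<ge> R"
    then have r: "r > 0" "q r > 0" using R q_pos by auto
    have d: "(?h has_real_derivative p' * ?h r * k r) (at r)"
      using DERIV_powr[OF q_deriv[OF r(1)] r(2) DERIV_const[of p']] by (simp add: k_def mult_ac)
    then have h': "deriv ?h r = p' * ?h r * k r"
      by (rule DERIV_imp_deriv)
    show "(?h has_real_derivative deriv ?h r) (at r)"
      using d h' by simp
    show "a * deriv ?h r = ?h r * k r"
      using h' p'_gt by (simp add: a_def)
    show "?h r > 0" using r by simp
    show "deriv ?h r > 0"
      using h' r p'_gt q'_pos by (simp add: k_def)
    show "deriv ?h r \<le> deriv ?h s" if "s \<ge> r" for s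
      using mono that r by (auto simp: mono_on_def)
  qed
  then show False
    using no_late_oscillation alt unfolding F_def by blast
qed

end
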